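(* Let $G$ be a $2$-connected graph containing a wheel $W_n$ as a proper subgraph. If $G/W_n$ admits a nowhere-zero $3$-flow, then $G$ admits an $S^1$-flow.
   Context: All graphs are finite and loopless; parallel edges are allowed. The wheel $W_n$ ($n\ge3$) is obtained from a cycle $C_n$ by adding a new vertex adjacent to every vertex of $C_n$. For a subgraph $H$ of $G$, $G/H$ is obtained by contracting all edges of $H$ and deleting the resulting loops, retaining parallel edges. For an orientation $D$ and $f:E(G)\to\mathbb{R}^d$, the boundary is $\partial_D f(v)=\sum_{e\in E_D^+(v)}f(e)-\sum_{e\in E_D^-(v)}f(e)$ (out-edges minus in-edges). For $\Omega\subseteq\mathbb{R}^d$, an $\Omega$-flow of $G$ is a pair $(D,f)$ with $D$ an orientation, $f:E(G)\to\Omega$ and $\partial_D f(v)=\mathbf{0}$ for every $v$. A nowhere-zero $3$-flow is a $\{\pm1,\pm2\}$-flow; an $S^1$-flow is the case $\Omega=S^1=\{\mathbf{x}\in\mathbb{R}^2:\|\mathbf{x}\|=1\}$. *)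

theory Defs
  imports "HOL-Analysis.Analysis" "Graph_Theory.Digraph"
begin

section \<open>Finite loopless multigraphs\<close>

text \<open>Edges are named objects, so distinct edges may have the same set of ends (parallel edges).
  Requiring every edge to have exactly two ends excludes loops.\<close>

record ('a, 'e) mgraph =
  gverts :: "'a set"
  gedges :: "'e set"
  gends :: "'e \<Rightarrow> 'a set"

definition finite_mgraph :: "('a, 'e) mgraph \<Rightarrow> bool" where
  "finite_mgraph G \<longleftrightarrow> finite (gverts G) \<and> finite (gedges G) \<and>
     (\<forall>e\<in>gedges G. gends G e \<subseteq> gverts G \<and> card (gends G e) = 2)"

definition subgraph_of :: "('a, 'e) mgraph \<Rightarrow> ('a, 'e) mgraph \<Rightarrow> bool" where
  "subgraph_of H G \<longleftrightarrow> finite_mgraph H \<and> gverts H \<subseteq> gverts G \<and> gedges H \<subseteq> gedges G \<and>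
     (\<forall>e\<in>gedges H. gends H e = gends G e)"

text \<open>The values of the field \<open>gends\<close> outside \<open>gedges\<close> are junk, so properness must not be stated
  as inequality of records.\<close>

definition proper_subgraph_of :: "('a, 'e) mgraph \<Rightarrow> ('a, 'e) mgraph \<Rightarrow> bool" where
  "proper_subgraph_of H G \<longleftrightarrow>
     subgraph_of H G \<and> (gverts H \<noteq> gverts G \<or> gedges H \<noteq> gedges G)"

definition isomorphic_mgraph :: "('a, 'e) mgraph \<Rightarrow> ('b, 'f) mgraph \<Rightarrow> bool" where
  "isomorphic_mgraph G H \<longleftrightarrow>
     (\<exists>\<phi> \<psi>. bij_betw \<phi> (gverts G) (gverts H) \<and> bij_betw \<psi> (gedges G) (gedges H) \<and>
        (\<forall>e\<in>gedges G. gends H (\<psi> e) = \<phi> ` gends G e))"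


section \<open>Connectivity\<close>

definition adjacency :: "('a, 'e) mgraph \<Rightarrow> 'a rel" where
  "adjacency G = {(u, v). \<exists>e\<in>gedges G. gends G e = {u, v}}"

definition connected_mgraph :: "('a, 'e) mgraph \<Rightarrow> bool" where
  "connected_mgraph G \<longleftrightarrow> gverts G \<noteq> {} \<and>
     (\<forall>u\<in>gverts G. \<forall>v\<in>gverts G. (u, v) \<in> (adjacency G)\<^sup>*)"

definition delete_verts :: "('a, 'e) mgraph \<Rightarrow> 'a set \<Rightarrow> ('a, 'e) mgraph" where
  "delete_verts G X =
     \<lparr>gverts = gverts G - X, gedges = {e \<in> gedges G. gends G e \<inter> X = {}}, gends = gends G\<rparr>"

definition k_connected :: "nat \<Rightarrow> ('a, 'e) mgraph \<Rightarrow> bool" where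
  "k_connected k G \<longleftrightarrow> card (gverts G) > k \<and>
     (\<forall>X. X \<subseteq> gverts G \<and> card X < k \<longrightarrow> connected_mgraph (delete_verts G X))"


section \<open>Wheels\<close>

text \<open>These two graphs are simple, so an edge is named by its own set of ends.
  The definitions describe the cycle and the wheel only for \<open>n \<ge> 3\<close>.\<close>

definition cycle_graph :: "nat \<Rightarrow> (nat, nat set) mgraph" where
  "cycle_graph n =
     \<lparr>gverts = {..<n}, gedges = {{i, Suc i mod n} | i. i < n}, gends = (\<lambda>e. e)\<rparr>"

definition wheel_graph :: "nat \<Rightarrow> (nat, nat set) mgraph" where
  "wheel_graph n =
     \<lparr>gverts = insert n (gverts (cycle_graph n)),
      gedges = gedges (cycle_graph n) \<union> {{n, v} | v. v \<in> gverts (cycle_graph n)},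
      gends = (\<lambda>e. e)\<rparr>"


section \<open>Contraction of a subgraph\<close>

text \<open>The vertices of \<open>G/H\<close> are the classes of vertices of \<open>G\<close> that get identified: the components
  of the spanning subgraph of \<open>G\<close> with edge set \<open>E(H)\<close>. An edge of \<open>G\<close> becomes a loop, and is
  deleted, exactly when its two ends lie in the same class; this holds for all edges of \<open>H\<close>.\<close>

definition contraction_class :: "('a, 'e) mgraph \<Rightarrow> ('a, 'e) mgraph \<Rightarrow> 'a \<Rightarrow> 'a set" where
  "contraction_class G H v = {u \<in> gverts G. (v, u) \<in> (adjacency H)\<^sup>*}"

definition contract :: "('a, 'e) mgraph \<Rightarrow> ('a, 'e) mgraph \<Rightarrow> ('a set, 'e) mgraph" where
  "contract G H =
     \<lparr>gverts = contraction_class G H ` gverts G,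
      gedges = {e \<in> gedges G. card (contraction_class G H ` gends G e) = 2},
      gends = (\<lambda>e. contraction_class G H ` gends G e)\<rparr>"


section \<open>Flows\<close>

text \<open>An orientation of \<open>G\<close> is a digraph whose arcs are the edges of \<open>G\<close>.\<close>

definition orientation_of :: "('a, 'e) pre_digraph \<Rightarrow> ('a, 'e) mgraph \<Rightarrow> bool" where
  "orientation_of D G \<longleftrightarrow> verts D = gverts G \<and> arcs D = gedges G \<and>
     (\<forall>e\<in>gedges G. gends G e = {tail D e, head D e})"

definition boundary :: "('a, 'e) pre_digraph \<Rightarrow> ('e \<Rightarrow> 'v::euclidean_space) \<Rightarrow> 'a \<Rightarrow> 'v" where
  "boundary D f v = (\<Sum>e\<in>out_arcs D v. f e) - (\<Sum>e\<in>in_arcs D v. f e)"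

definition is_flow ::
  "'v::euclidean_space set \<Rightarrow> ('a, 'e) mgraph \<Rightarrow> ('a, 'e) pre_digraph \<Rightarrow> ('e \<Rightarrow> 'v) \<Rightarrow> bool" where
  "is_flow \<Omega> G D f \<longleftrightarrow> orientation_of D G \<and> (\<forall>e\<in>gedges G. f e \<in> \<Omega>) \<and>
     (\<forall>v\<in>gverts G. boundary D f v = 0)"

definition admits_flow :: "'v::euclidean_space set \<Rightarrow> ('a, 'e) mgraph \<Rightarrow> bool" where
  "admits_flow \<Omega> G \<longleftrightarrow> (\<exists>D f. is_flow \<Omega> G D f)"

definition admits_nowhere_zero_3_flow :: "('a, 'e) mgraph \<Rightarrow> bool" where
  "admits_nowhere_zero_3_flow G \<longleftrightarrow> admits_flow {1, -1, 2, -2 :: real} G"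

definition admits_S1_flow :: "('a, 'e) mgraph \<Rightarrow> bool" where
  "admits_S1_flow G \<longleftrightarrow> admits_flow {x :: real ^ 2. norm x = 1} G"

end

theory Submission
  imports Defs "Graph_Theory.Arc_Walk"
begin

text \<open>Write \<open>\<Gamma>\<close> for \<open>G\<close> without the edges of the wheel \<open>H\<close>. A nowhere-zero 3-flow of the contraction gives an
  orientation of \<open>\<Gamma>\<close> in which out-degree minus in-degree, \<open>d v\<close>, is divisible by three at every vertex outside
  the wheel (lemma \<open>orientation_from_contraction\<close>). If the arcs of \<open>\<Gamma>\<close> are then split into three parts that
  share \<open>d v\<close> as evenly as possible at every vertex, and the parts receive the three cube roots of unity as
  values, the boundary at \<open>v\<close> is zero if three divides \<open>d v\<close>, and a unit vector otherwise
  (\<open>unit_or_zero_boundary\<close>). Such splittings exist because flows can be rounded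
  (\<open>boundary_rounding\<close>).

  It remains to give values to the edges of the wheel so that the boundaries \<open>\<beta> i\<close> at the rim vertices are
  cancelled; the hub is then balanced automatically. In terms of the rim values \<open>x i\<close> this asks for a
  closed sequence of unit vectors with \<open>norm (x i - x (i - 1) + \<beta> i) = 1\<close> throughout. A vertex with \<open>\<beta> i = 0\<close>
  turns the rim value by sixty degrees in either direction, whereas a vertex where \<open>\<beta> i\<close> is a unit vector
  may reset it to \<open>- \<beta> i\<close>. Hence the sequence can be closed if some \<open>\<beta> i\<close> is a unit vector
  (\<open>closes_wheel_unit\<close>), or if all are zero and \<open>n\<close> is even (\<open>closes_wheel_even\<close>).

  The remaining case is that \<open>n\<close> is odd and three divides \<open>d v\<close> everywhere. This is where 2-connectedness and
  the properness of the subgraph enter: two distinct vertices \<open>u\<close> and \<open>w\<close> of the wheel are joined by a path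
  of \<open>\<Gamma>\<close> (\<open>two_attached_vertices\<close>). The splitting into three parts can be disturbed so that the boundaries at
  \<open>u\<close> and \<open>w\<close> become opposite vectors of length \<open>sqrt 3\<close> while all others stay zero
  (\<open>sqrt3_boundary_at_two_vertices\<close>), and for these demands a wheel with odd rim can again be closed
  (\<open>closes_wheel_one_sqrt3\<close> if the hub is one of the two vertices, \<open>closes_wheel_two_sqrt3\<close> if both lie on the
  rim). By parity, the rim values cannot all be sixth roots of unity in this case, as the cube roots of unity
  elsewhere would suggest; the isosceles triangle with sides \<open>sqrt 3\<close>, \<open>sqrt 3\<close> and \<open>1\<close> provides other
  directions.\<close>

section \<open>Boundaries\<close>

lemma boundary_eq_sum:
  assumes "finite (arcs D)"
  shows "boundary D f v =
    (\<Sum>e\<in>arcs D. (if tail D e = v then f e else 0) - (if head D e = v then f e else 0))"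
proof -
  have "(\<Sum>e\<in>out_arcs D v. f e) = (\<Sum>e\<in>arcs D. if tail D e = v then f e else 0)"
    unfolding out_arcs_def by (rule sum.inter_filter[OF assms])
  moreover have "(\<Sum>e\<in>in_arcs D v. f e) = (\<Sum>e\<in>arcs D. if head D e = v then f e else 0)"
    unfolding in_arcs_def by (rule sum.inter_filter[OF assms])
  ultimately show ?thesis
    by (simp add: boundary_def sum_subtractf)
qed

lemma sum_boundary:
  assumes "finite (arcs D)" "finite S"
  shows "(\<Sum>v\<in>S. boundary D f v) =
    (\<Sum>e\<in>arcs D. (if tail D e \<in> S then f e else 0) - (if head D e \<in> S then f e else 0))"
proof -
  have "(\<Sum>v\<in>S. boundary D f v) =
    (\<Sum>e\<in>arcs D. \<Sum>v\<in>S. (if tail D e = v then f e else 0) - (if head D e = v then f e else 0))"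
    unfolding boundary_eq_sum[OF assms(1)] by (rule sum.swap)
  also have "\<dots> = (\<Sum>e\<in>arcs D. (if tail D e \<in> S then f e else 0) - (if head D e \<in> S then f e else 0))"
    using assms(2) by (simp add: sum_subtractf)
  finally show ?thesis .
qed

lemma sum_boundary_verts:
  assumes "fin_digraph D"
  shows "(\<Sum>v\<in>verts D. boundary D f v) = 0"
proof -
  interpret fin_digraph D by fact
  show ?thesis
    using sum_boundary[OF finite_arcs finite_verts, of f] by (simp add: wellformed)
qed

lemma boundary_add: "boundary D (\<lambda>e. f e + g e) v = boundary D f v + boundary D g v"
  by (simp add: boundary_def sum.distrib)

lemma boundary_diff: "boundary D (\<lambda>e. f e - g e) v = boundary D f v - boundary D g v"
  by (simp add: boundary_def sum_subtractf)

lemma boundary_linear: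
  assumes "linear L"
  shows "boundary D (\<lambda>e. L (f e)) v = L (boundary D f v)"
  by (simp add: boundary_def linear_sum[OF assms] linear_diff[OF assms])

lemma boundary_cong:
  assumes "\<And>e. e \<in> arcs D \<Longrightarrow> f e = g e"
  shows "boundary D f v = boundary D g v"
proof -
  have "(\<Sum>e\<in>out_arcs D v. f e) = (\<Sum>e\<in>out_arcs D v. g e)"
    by (rule sum.cong) (auto simp: assms)
  moreover have "(\<Sum>e\<in>in_arcs D v. f e) = (\<Sum>e\<in>in_arcs D v. g e)"
    by (rule sum.cong) (auto simp: assms)
  ultimately show ?thesis by (simp add: boundary_def)
qed

lemma boundary_single:
  assumes "finite (arcs D)" "e \<in> arcs D"
  shows "boundary D (\<lambda>a. if a = e then c else 0) v =
    (if tail D e = v then c else 0) - (if head D e = v then c else 0)"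
proof -
  have "boundary D (\<lambda>a. if a = e then c else 0) v = (\<Sum>a\<in>arcs D. if a = e then
      (if tail D e = v then c else 0) - (if head D e = v then c else 0) else 0)"
    unfolding boundary_eq_sum[OF assms(1)] by (rule sum.cong) auto
  then show ?thesis using assms by simp
qed

lemma boundary_indicator_int:
  obtains k :: int where "boundary D (indicat_real M) v = real_of_int k"
proof -
  have "boundary D (indicat_real M) v \<in> \<int>"
    unfolding boundary_def by (intro Ints_diff Ints_sum) (auto simp: indicator_def)
  then show ?thesis by (auto elim: Ints_cases intro: that)
qed

section \<open>Augmenting paths and rounding\<close>

text \<open>Exchanging the arcs of a walk in this digraph in or out of \<open>M\<close> is the residual-graph step of network
  flow theory for unit capacities: an unused arc may be taken, a used one may be given back.\<close>

definition residual :: "('a, 'e) pre_digraph \<Rightarrow> 'e set \<Rightarrow> ('a, 'e) pre_digraph" where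
  "residual D M = D\<lparr>tail := \<lambda>e. if e \<in> M then head D e else tail D e,
                    head := \<lambda>e. if e \<in> M then tail D e else head D e\<rparr>"

lemma residual_simps [simp]:
  "verts (residual D M) = verts D" "arcs (residual D M) = arcs D"
  "tail (residual D M) e = (if e \<in> M then head D e else tail D e)"
  "head (residual D M) e = (if e \<in> M then tail D e else head D e)"
  by (simp_all add: residual_def)

lemma wf_residual: "wf_digraph D \<Longrightarrow> wf_digraph (residual D M)"
  by (auto simp: wf_digraph_def)

text \<open>Along a walk of the residual digraph the contributions of consecutive arcs cancel, so only the
  two ends are affected. The arcs have to be distinct, since the direction in which an arc may be traversed
  changes once it has been exchanged.\<close>

lemma boundary_flip_trail:
  assumes "finite (arcs D)" "set p \<subseteq> arcs D" "distinct p"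
    and "pre_digraph.cas (residual D M) u p w"
  shows "boundary D (indicat_real ((M - set p) \<union> (set p - M))) v =
    boundary D (indicat_real M) v + (if v = u then 1 else 0) - (if v = w then 1 else 0)"
  using assms(2-)
proof (induction p arbitrary: u)
  case Nil
  then show ?case by (simp add: pre_digraph.cas.simps)
next
  case (Cons e p)
  let ?flip = "\<lambda>q. (M - set q) \<union> (set q - M)"
  let ?c = "if e \<in> M then - 1 else 1 :: real"
  have eq: "indicat_real (?flip (e # p)) = (\<lambda>a. indicat_real (?flip p) a + (if a = e then ?c else 0))"
    using Cons.prems by (auto simp: indicator_def fun_eq_iff)
  have u: "u = tail (residual D M) e" and c: "pre_digraph.cas (residual D M) (head (residual D M) e) p w"
    using Cons.prems by (auto simp: pre_digraph.cas.simps)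
  have ih: "boundary D (indicat_real (?flip p)) v = boundary D (indicat_real M) v
    + (if v = head (residual D M) e then 1 else 0) - (if v = w then 1 else 0)"
    by (rule Cons.IH) (use Cons.prems c in auto)
  have "boundary D (indicat_real (?flip (e # p))) v = boundary D (indicat_real (?flip p)) v
      + ((if tail D e = v then ?c else 0) - (if head D e = v then ?c else 0))"
    unfolding eq boundary_add using boundary_single[OF assms(1), of e ?c v] Cons.prems by simp
  then show ?case
    unfolding ih u by (auto split: if_splits)
qed

lemma residual_augment:
  assumes "fin_digraph D" "M \<subseteq> arcs D" "u \<rightarrow>\<^sup>*\<^bsub>residual D M\<^esub> w"
  obtains M' where "M' \<subseteq> arcs D" and "\<And>v. boundary D (indicat_real M') v =
    boundary D (indicat_real M) v + (if v = u then 1 else 0) - (if v = w then 1 else 0)"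
proof -
  interpret fin_digraph D by fact
  interpret R: wf_digraph "residual D M" by (rule wf_residual) unfold_locales
  obtain q where q: "R.awalk u q w" using assms(3) R.reachable_awalk by blast
  define p where "p = R.awalk_to_apath q"
  have p: "R.apath u p w" unfolding p_def using q by (rule R.apath_awalk_to_apath)
  then have a: "R.awalk u p w" and d: "distinct p"
    by (auto simp: R.apath_def intro: R.distinct_verts_imp_distinct)
  show ?thesis
  proof (rule that[of "(M - set p) \<union> (set p - M)"])
    show "(M - set p) \<union> (set p - M) \<subseteq> arcs D"
      using a assms(2) by (auto simp: R.awalk_def)
  qed (rule boundary_flip_trail[OF finite_arcs _ d], use a in \<open>auto simp: R.awalk_def\<close>)
qed

text \<open>A set closed under residual reachability is saturated: no further arc leaving it can be taken
  and no arc entering it can be given back.\<close>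

lemma residual_reachable_arcs:
  assumes "wf_digraph D" "M \<subseteq> arcs D" "u \<in> verts D" "e \<in> arcs D"
    and "S = {v. u \<rightarrow>\<^sup>*\<^bsub>residual D M\<^esub> v}"
  shows "tail D e \<in> S \<Longrightarrow> head D e \<notin> S \<Longrightarrow> e \<in> M"
    and "tail D e \<notin> S \<Longrightarrow> head D e \<in> S \<Longrightarrow> e \<notin> M"
proof -
  interpret R: wf_digraph "residual D M" by (rule wf_residual) fact
  have "tail (residual D M) e \<rightarrow>\<^bsub>residual D M\<^esub> head (residual D M) e"
    using assms(4) by (intro R.in_arcs_imp_in_arcs_ends) simp
  then have "tail (residual D M) e \<in> S \<Longrightarrow> head (residual D M) e \<in> S"
    unfolding assms(5) by (auto intro: R.reachable_adj_trans)
  then have "(e \<notin> M \<longrightarrow> tail D e \<in> S \<longrightarrow> head D e \<in> S) \<and> (e \<in> M \<longrightarrow> head D e \<in> S \<longrightarrow> tail D e \<in> S)"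
    by (cases "e \<in> M") simp_all
  then show "tail D e \<in> S \<Longrightarrow> head D e \<notin> S \<Longrightarrow> e \<in> M"
    and "tail D e \<notin> S \<Longrightarrow> head D e \<in> S \<Longrightarrow> e \<notin> M"
    by auto
qed

text \<open>On a saturated set the boundary of \<open>M\<close> counts all leaving and no entering arcs, which is the
  largest value that any subset of the arcs could give. The fraction \<open>c\<close> of the full boundary is therefore
  at most as large, and equality means that no arc leaves or enters at all.\<close>

lemma residual_reachable_excess:
  fixes c :: real
  assumes "fin_digraph D" "M \<subseteq> arcs D" "u \<in> verts D" "0 < c" "c < 1"
    and S: "S = {v. u \<rightarrow>\<^sup>*\<^bsub>residual D M\<^esub> v}"
  defines "g \<equiv> \<lambda>v. boundary D (indicat_real M) v - c * boundary D (\<lambda>_. 1) v"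
  shows "0 \<le> (\<Sum>v\<in>S. g v)"
    and "(\<Sum>v\<in>S. g v) = 0 \<Longrightarrow> e \<in> arcs D \<Longrightarrow> tail D e \<in> S \<longleftrightarrow> head D e \<in> S"
proof -
  interpret fin_digraph D by fact
  interpret R: wf_digraph "residual D M" by (rule wf_residual) unfold_locales
  have "S \<subseteq> verts D" using S R.reachable_in_verts(2) by fastforce
  then have fS: "finite S" using finite_verts finite_subset by blast
  define h where "h e = (if tail D e \<in> S then indicat_real M e - c else 0)
    - (if head D e \<in> S then indicat_real M e - c else 0)" for e
  have "g = boundary D (\<lambda>e. indicat_real M e - c)"
  proof
    fix v show "g v = boundary D (\<lambda>e. indicat_real M e - c) v"
      using boundary_linear[of "\<lambda>x::real. c * x" D "\<lambda>_. 1" v]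
      by (simp add: g_def boundary_diff linear_times)
  qed
  then have eq: "(\<Sum>v\<in>S. g v) = (\<Sum>e\<in>arcs D. h e)"
    by (simp add: sum_boundary[OF finite_arcs fS] h_def)
  note arcs = residual_reachable_arcs[OF wf_digraph assms(2,3) _ S]
  have nonneg: "0 \<le> h e" if "e \<in> arcs D" for e
    using arcs[OF that] assms(4,5) by (auto simp: h_def indicator_def)
  then show "0 \<le> (\<Sum>v\<in>S. g v)" unfolding eq by (rule sum_nonneg)
  assume "(\<Sum>v\<in>S. g v) = 0" and e: "e \<in> arcs D"
  then have "h e = 0" using eq sum_nonneg_eq_0_iff[OF finite_arcs nonneg] by simp
  then show "tail D e \<in> S \<longleftrightarrow> head D e \<in> S"
    using arcs[OF e] assms(4,5) by (auto simp: h_def indicator_def split: if_splits)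
qed

text \<open>If \<open>u\<close> falls short of its target by at least one, then some vertex in the saturated set
  around \<open>u\<close> is above its target; moving one unit from there to \<open>u\<close> lowers the sum of the squared errors.\<close>

lemma boundary_rounding_step:
  fixes c :: real
  assumes "fin_digraph D" "M \<subseteq> arcs D" "0 < c" "c < 1" "u \<in> verts D"
    and "boundary D (indicat_real M) u - c * boundary D (\<lambda>_. 1) u \<le> - 1"
  obtains M' where "M' \<subseteq> arcs D"
    "(\<Sum>v\<in>verts D. (boundary D (indicat_real M') v - c * boundary D (\<lambda>_. 1) v)\<^sup>2)
     < (\<Sum>v\<in>verts D. (boundary D (indicat_real M) v - c * boundary D (\<lambda>_. 1) v)\<^sup>2)"
proof -
  interpret fin_digraph D by fact
  interpret R: wf_digraph "residual D M" by (rule wf_residual) unfold_locales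
  define g where "g v = boundary D (indicat_real M) v - c * boundary D (\<lambda>_. 1) v" for v
  define S where "S = {v. u \<rightarrow>\<^sup>*\<^bsub>residual D M\<^esub> v}"
  have SV: "S \<subseteq> verts D" using S_def R.reachable_in_verts(2) by fastforce
  then have fS: "finite S" using finite_verts finite_subset by blast
  have uS: "u \<in> S" using assms(5) by (simp add: S_def)
  have "0 \<le> (\<Sum>v\<in>S. g v)"
    unfolding g_def by (rule residual_reachable_excess(1)[OF assms(1,2,5,3,4) S_def])
  also have "\<dots> = g u + (\<Sum>v\<in>S - {u}. g v)" using fS uS by (rule sum.remove)
  finally have "0 < (\<Sum>v\<in>S - {u}. g v)" using assms(6) by (simp add: g_def)
  then obtain w where w: "w \<in> S - {u}" "0 < g w"
    by (meson leD not_le_imp_less sum_nonpos)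
  then obtain M' where M': "M' \<subseteq> arcs D" "\<And>v. boundary D (indicat_real M') v =
    boundary D (indicat_real M) v + (if v = u then 1 else 0) - (if v = w then 1 else 0)"
    using residual_augment[OF assms(1,2), of u w] unfolding S_def by auto
  define g' where "g' v = boundary D (indicat_real M') v - c * boundary D (\<lambda>_. 1) v" for v
  have g': "g' v = g v + (if v = u then 1 else 0) - (if v = w then 1 else 0)" for v
    by (simp add: g'_def g_def M'(2))
  have split: "(\<Sum>v\<in>verts D. (f v)\<^sup>2) = (f u)\<^sup>2 + (f w)\<^sup>2 + (\<Sum>v\<in>verts D - {u} - {w}. (f v)\<^sup>2)"
    for f :: "'a \<Rightarrow> real"
  proof -
    have "(\<Sum>v\<in>verts D. (f v)\<^sup>2) = (f u)\<^sup>2 + (\<Sum>v\<in>verts D - {u}. (f v)\<^sup>2)"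
      using assms(5) by (intro sum.remove) auto
    moreover have "(\<Sum>v\<in>verts D - {u}. (f v)\<^sup>2) = (f w)\<^sup>2 + (\<Sum>v\<in>verts D - {u} - {w}. (f v)\<^sup>2)"
      using w SV by (intro sum.remove) auto
    ultimately show ?thesis by simp
  qed
  have "(\<Sum>v\<in>verts D - {u} - {w}. (g' v)\<^sup>2) = (\<Sum>v\<in>verts D - {u} - {w}. (g v)\<^sup>2)"
    by (rule sum.cong) (auto simp: g')
  moreover have "(g' u)\<^sup>2 + (g' w)\<^sup>2 < (g u)\<^sup>2 + (g w)\<^sup>2"
  proof -
    have eqs: "g' u = g u + 1" "g' w = g w - 1" using w by (auto simp: g')
    have "(g' u)\<^sup>2 + (g' w)\<^sup>2 = (g u)\<^sup>2 + (g w)\<^sup>2 + 2 * (g u + 1 - g w)"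
      unfolding eqs by (simp add: power2_eq_square algebra_simps)
    then show ?thesis using w(2) assms(6) by (simp add: g_def)
  qed
  ultimately have "(\<Sum>v\<in>verts D. (g' v)\<^sup>2) < (\<Sum>v\<in>verts D. (g v)\<^sup>2)"
    unfolding split[of g] split[of g'] by simp
  then show ?thesis using that M'(1) unfolding g_def g'_def by blast
qed

text \<open>An integrality property of flows: the fractional vector that is constantly \<open>c\<close> can be
  rounded to a zero-one vector without changing any boundary by one or more. A set that minimises the sum of
  the squared errors does it.\<close>

lemma boundary_rounding:
  fixes c :: real
  assumes "fin_digraph D" "0 < c" "c < 1"
  obtains M where "M \<subseteq> arcs D"
    "\<And>v. v \<in> verts D \<Longrightarrow> \<bar>boundary D (indicat_real M) v - c * boundary D (\<lambda>_. 1) v\<bar> < 1"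
proof -
  interpret fin_digraph D by fact
  define cost where "cost a M = (\<Sum>v\<in>verts D. (boundary D (indicat_real M) v - a * boundary D (\<lambda>_. 1) v)\<^sup>2)"
    for a :: real and M
  have "finite (cost c ` Pow (arcs D))" "cost c ` Pow (arcs D) \<noteq> {}" by auto
  from Min_in[OF this] obtain M where M: "M \<subseteq> arcs D" "cost c M = Min (cost c ` Pow (arcs D))"
    by auto
  then have min: "cost c M \<le> cost c M'" if "M' \<subseteq> arcs D" for M'
    using that by auto
  \<comment> \<open>A surplus of \<open>M\<close> is a shortfall of its complement, with \<open>1 - c\<close> in place of \<open>c\<close>.\<close>
  have compl: "boundary D (indicat_real (arcs D - M')) v = boundary D (\<lambda>_. 1) v - boundary D (indicat_real M') v"
    for M' v
    unfolding boundary_diff[symmetric] by (rule boundary_cong) (auto simp: indicator_def)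
  have cost_compl: "cost (1 - c) (arcs D - M') = cost c M'" for M'
    unfolding cost_def compl by (rule sum.cong) (auto simp: power2_eq_square algebra_simps)
  have "\<bar>boundary D (indicat_real M) v - c * boundary D (\<lambda>_. 1) v\<bar> < 1" if v: "v \<in> verts D" for v
  proof (rule ccontr)
    assume "\<not> ?thesis"
    then consider "boundary D (indicat_real M) v - c * boundary D (\<lambda>_. 1) v \<le> - 1"
      | "boundary D (indicat_real (arcs D - M)) v - (1 - c) * boundary D (\<lambda>_. 1) v \<le> - 1"
      unfolding compl left_diff_distrib by linarith
    then show False
    proof cases
      case 1
      from boundary_rounding_step[OF assms(1) M(1) assms(2,3) v this]
      obtain M' where "M' \<subseteq> arcs D" "cost c M' < cost c M"
        unfolding cost_def .
      then show False using min[of M'] by simp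
    next
      case 2
      have "arcs D - M \<subseteq> arcs D" "0 < 1 - c" "1 - c < 1" using assms(2,3) by auto
      from boundary_rounding_step[OF assms(1) this v 2]
      obtain M' where M': "M' \<subseteq> arcs D" "cost (1 - c) M' < cost (1 - c) (arcs D - M)"
        unfolding cost_def .
      then have "cost c (arcs D - M') < cost c M"
        using cost_compl[of "arcs D - M'"] cost_compl[of M] by (simp add: double_diff[OF _ order_refl])
      then show False using min[of "arcs D - M'"] by auto
    qed
  qed
  then show ?thesis using that M(1) by blast
qed

section \<open>Flows with cube roots of unity as values\<close>

text \<open>A primitive sixth root of unity. The cube roots of unity are \<open>1\<close>, \<open>\<zeta> - 1\<close> and \<open>- \<zeta>\<close>, and
  the unit vectors at unit distance from a unit vector \<open>z\<close> are \<open>z * \<zeta>\<close> and \<open>z / \<zeta>\<close>.\<close>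

definition \<zeta> :: complex where "\<zeta> = Complex (1/2) (sqrt 3 / 2)"

lemma zeta_square: "\<zeta>\<^sup>2 = \<zeta> - 1"
  by (simp add: \<zeta>_def complex_eq_iff power2_eq_square)

lemma norm_zeta [simp]: "norm \<zeta> = 1"
  by (simp add: \<zeta>_def cmod_def power_divide)

lemma norm_zeta_minus_1 [simp]: "norm (\<zeta> - 1) = 1"
  by (metis norm_one norm_power norm_zeta power_one zeta_square)

lemma norm_zeta_plus_1: "norm (1 + \<zeta>) = sqrt 3"
  by (simp add: \<zeta>_def cmod_def power_divide)

lemma norm_one_minus_zeta_square: "norm (1 - \<zeta>\<^sup>2) = sqrt 3"
proof -
  have "1 - \<zeta>\<^sup>2 = (1 - \<zeta>) * (1 + \<zeta>)" by (simp add: power2_eq_square algebra_simps)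
  then show ?thesis by (simp add: norm_mult norm_zeta_plus_1 norm_minus_commute[of 1 \<zeta>])
qed

lemma norm_cube_root_combination:
  fixes p q r :: real
  shows "(norm (p + q * (\<zeta> - 1) - r * \<zeta>))\<^sup>2 = p\<^sup>2 + q\<^sup>2 + r\<^sup>2 - p * q - q * r - p * r"
proof -
  let ?z = "p + q * (\<zeta> - 1) - r * \<zeta>"
  have re_im: "Re ?z = p - (q + r) / 2" "Im ?z = sqrt 3 * ((q - r) / 2)"
    by (simp_all add: \<zeta>_def field_simps)
  have "(norm ?z)\<^sup>2 = (p - (q + r) / 2)\<^sup>2 + 3 * ((q - r) / 2)\<^sup>2"
    unfolding cmod_power2 re_im by (simp add: power_mult_distrib power_divide)
  then show ?thesis
    by (simp add: power2_eq_square field_simps)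
qed

lemma norm_cube_root_combination_int:
  fixes p q r k :: int
  assumes "p\<^sup>2 + q\<^sup>2 + r\<^sup>2 - p * q - q * r - p * r = k"
  shows "norm (of_int p + of_int q * (\<zeta> - 1) - of_int r * \<zeta>) = sqrt k"
proof -
  have "(norm (of_int p + of_int q * (\<zeta> - 1) - of_int r * \<zeta>))\<^sup>2 = real_of_int k"
    using norm_cube_root_combination[of "of_int p" "of_int q" "of_int r"]
    unfolding assms[symmetric] by simp
  then show ?thesis by (metis norm_ge_zero real_sqrt_unique)
qed

text \<open>Rounding a third of an integer and then half of what is left gives three parts of which at
  least two agree, while the third differs from them by at most one. The quadratic
  form is the squared norm of the boundary that results when the parts get the three cube roots of unity.\<close>

lemma near_balanced_triple:
  fixes p q r :: int
  assumes "\<bar>3 * p - (p + q + r)\<bar> < 3" "\<bar>q - r\<bar> \<le> 1" "\<not> (q = p \<and> r = p)"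
  shows "p\<^sup>2 + q\<^sup>2 + r\<^sup>2 - p * q - q * r - p * r = 1"
proof -
  consider "q = r" | "q = r + 1" | "q = r - 1" using assms(2) by linarith
  then have "(p = r - 1 \<and> q = r) \<or> (p = r + 1 \<and> q = r) \<or> (p = r \<and> q = r + 1) \<or> (p = r + 1 \<and> q = r + 1)
    \<or> (p = r \<and> q = r - 1) \<or> (p = r - 1 \<and> q = r - 1)"
  proof cases
    case 1
    then have "p = r - 1 \<or> p = r + 1" using assms by linarith
    with 1 show ?thesis by simp
  next
    case 2
    then have "p = r \<or> p = r + 1" using assms(1) by linarith
    with 2 show ?thesis by simp
  next
    case 3
    then have "p = r \<or> p = r - 1" using assms(1) by linarith
    with 3 show ?thesis by simp
  qed
  then show ?thesis by (auto simp: power2_eq_square algebra_simps)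
qed
text \<open>The parts at a vertex to which one unit has been shifted are \<open>p\<close>, \<open>p - 1\<close> and \<open>p - 2\<close>; parity
  excludes that the two smaller ones agree.\<close>

lemma unbalanced_triple:
  fixes p q r :: int
  assumes "\<bar>q - r\<bar> \<le> 1" "3 * p = p + q + r + 3"
  shows "p\<^sup>2 + q\<^sup>2 + r\<^sup>2 - p * q - q * r - p * r = 3"
proof -
  have "2 * p = q + r + 3" using assms(2) by simp
  then have "q \<noteq> r" by presburger
  then consider "q = r + 1" | "q = r - 1" using assms(1) by linarith
  then have "(q = p - 1 \<and> r = p - 2) \<or> (r = p - 1 \<and> q = p - 2)" by cases (use assms(2) in auto)
  then show ?thesis by (auto simp: power2_eq_square algebra_simps)
qed

text \<open>The arcs of \<open>M\<close> receive the value \<open>1\<close> and the others are shared out between the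
  two remaining cube roots of unity, as evenly as possible at every vertex. If \<open>M\<close> is a perfect
  matching of a bipartite cubic graph oriented from one side to the other, this is a 3-edge-colouring.\<close>

lemma cube_root_colouring:
  assumes "fin_digraph D" "M \<subseteq> arcs D"
  obtains f :: "'e \<Rightarrow> complex" where "\<And>e. norm (f e) = 1"
    and "\<And>v. v \<in> verts D \<Longrightarrow> \<exists>p q r :: int. \<bar>q - r\<bar> \<le> 1 \<and>
      boundary D (indicat_real M) v = real_of_int p \<and>
      boundary D (\<lambda>_. 1 :: real) v = real_of_int (p + q + r) \<and>
      boundary D f v = of_int p + of_int q * (\<zeta> - 1) - of_int r * \<zeta>"
proof -
  interpret fin_digraph D by fact
  define D2 where "D2 = D\<lparr>arcs := arcs D - M\<rparr>"
  have D2: "fin_digraph D2"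
    by (auto simp: fin_digraph_def wf_digraph_def fin_digraph_axioms_def D2_def)
  have bD2: "boundary D2 g v = boundary D (\<lambda>e. if e \<in> M then 0 else g e) v" for g :: "'e \<Rightarrow> real" and v
    unfolding boundary_eq_sum[OF fin_digraph.finite_arcs[OF D2]] boundary_eq_sum[OF finite_arcs]
    by (rule sum.mono_neutral_cong_left) (auto simp: D2_def)
  obtain N where N: "N \<subseteq> arcs D2" and N_round: "\<And>v. v \<in> verts D2 \<Longrightarrow>
    \<bar>boundary D2 (indicat_real N) v - 1/2 * boundary D2 (\<lambda>_. 1) v\<bar> < 1"
    using boundary_rounding[OF D2, of "1/2"] by auto
  define f where "f e = (if e \<in> M then 1 else if e \<in> N then \<zeta> - 1 else - \<zeta>)" for e
  show ?thesis
  proof (rule that[of f])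
    show "norm (f e) = 1" for e by (simp add: f_def)
  next
    fix v assume v: "v \<in> verts D"
    let ?b = "\<lambda>X. boundary D (indicat_real X) v"
    obtain p where p: "?b M = real_of_int p"
      by (rule boundary_indicator_int)
    obtain q where q: "?b N = real_of_int q"
      by (rule boundary_indicator_int)
    obtain r where r: "?b (arcs D - M - N) = real_of_int r"
      by (rule boundary_indicator_int)
    have 1: "boundary D (\<lambda>_. 1 :: real) v = real_of_int (p + q + r)"
      unfolding of_int_add p[symmetric] q[symmetric] r[symmetric] boundary_add[symmetric]
      using N by (intro boundary_cong) (auto simp: indicator_def D2_def)
    have "boundary D2 (indicat_real N) v = q" unfolding q[symmetric] bD2
      using N by (intro boundary_cong) (auto simp: indicator_def D2_def)
    moreover have "boundary D2 (\<lambda>_. 1 :: real) v = q + r"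
      unfolding q[symmetric] r[symmetric] boundary_add[symmetric] of_int_add bD2
      using N by (intro boundary_cong) (auto simp: indicator_def D2_def)
    ultimately have "\<bar>real_of_int q - 1/2 * (q + r)\<bar> < 1"
      using N_round[of v] v by (simp add: D2_def)
    then have "\<bar>real_of_int (q - r)\<bar> < 2" by (simp add: field_simps abs_if split: if_splits)
    then have 2: "\<bar>q - r\<bar> \<le> 1" by linarith
    have lin: "linear (\<lambda>x::real. of_real x * z)" for z :: complex
      by (auto simp: linear_iff algebra_simps scaleR_conv_of_real)
    have "boundary D f v = boundary D (\<lambda>e. (of_real (indicat_real M e) * 1 + of_real (indicat_real N e) * (\<zeta> - 1))
      + of_real (indicat_real (arcs D - M - N) e) * (- \<zeta>)) v"
      using N by (intro boundary_cong) (auto simp: f_def indicator_def D2_def)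
    also have "\<dots> = of_int p + of_int q * (\<zeta> - 1) - of_int r * \<zeta>"
      unfolding boundary_add boundary_linear[OF lin] p q r by simp
    finally show "\<exists>p q r :: int. \<bar>q - r\<bar> \<le> 1 \<and>
      boundary D (indicat_real M) v = real_of_int p \<and>
      boundary D (\<lambda>_. 1 :: real) v = real_of_int (p + q + r) \<and>
      boundary D f v = of_int p + of_int q * (\<zeta> - 1) - of_int r * \<zeta>"
      using 1 2 p by blast
  qed
qed

text \<open>Splitting the arcs into three parts that are as equal as possible at every vertex makes the
  three cube roots of unity cancel except for at most one surplus or missing value.\<close>

lemma unit_or_zero_boundary:
  assumes "fin_digraph D"
  obtains f :: "'e \<Rightarrow> complex" where "\<And>e. norm (f e) = 1"
    and "\<And>v k :: int. v \<in> verts D \<Longrightarrow> boundary D (\<lambda>_. 1 :: real) v = 3 * k \<Longrightarrow> boundary D f v = 0"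
    and "\<And>v. v \<in> verts D \<Longrightarrow> \<nexists>k :: int. boundary D (\<lambda>_. 1 :: real) v = 3 * k \<Longrightarrow> norm (boundary D f v) = 1"
proof -
  obtain M where M: "M \<subseteq> arcs D"
    "\<And>v. v \<in> verts D \<Longrightarrow> \<bar>boundary D (indicat_real M) v - 1/3 * boundary D (\<lambda>_. 1) v\<bar> < 1"
    using boundary_rounding[OF assms, of "1/3"] by auto
  obtain f :: "'e \<Rightarrow> complex" where f: "\<And>e. norm (f e) = 1"
    and ex: "\<And>v. v \<in> verts D \<Longrightarrow> \<exists>p q r :: int. \<bar>q - r\<bar> \<le> 1 \<and>
      boundary D (indicat_real M) v = real_of_int p \<and>
      boundary D (\<lambda>_. 1 :: real) v = real_of_int (p + q + r) \<and>
      boundary D f v = of_int p + of_int q * (\<zeta> - 1) - of_int r * \<zeta>"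
    using cube_root_colouring[OF assms M(1)] by blast
  have *: "\<exists>p q r :: int. \<bar>3 * p - (p + q + r)\<bar> < 3 \<and> \<bar>q - r\<bar> \<le> 1 \<and>
      boundary D (\<lambda>_. 1 :: real) v = real_of_int (p + q + r) \<and>
      boundary D f v = of_int p + of_int q * (\<zeta> - 1) - of_int r * \<zeta>"
    if v: "v \<in> verts D" for v
  proof -
    obtain p q r :: int where qr: "\<bar>q - r\<bar> \<le> 1" "boundary D (indicat_real M) v = real_of_int p"
      "boundary D (\<lambda>_. 1 :: real) v = real_of_int (p + q + r)"
      "boundary D f v = of_int p + of_int q * (\<zeta> - 1) - of_int r * \<zeta>"
      using ex[OF v] by blast
    have "\<bar>real_of_int (3 * p - (p + q + r))\<bar> < 3"
      using M(2)[OF v] qr(2,3) unfolding of_int_diff of_int_add of_int_mult of_int_numeral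
      by linarith
    then have "\<bar>3 * p - (p + q + r)\<bar> < 3" by linarith
    then show ?thesis using qr(1,3,4) by blast
  qed
  show ?thesis
  proof (rule that[OF f])
    fix v and k :: int assume v: "v \<in> verts D" and k: "boundary D (\<lambda>_. 1 :: real) v = 3 * real_of_int k"
    obtain p q r :: int where pqr: "\<bar>3 * p - (p + q + r)\<bar> < 3" "\<bar>q - r\<bar> \<le> 1"
      "boundary D (\<lambda>_. 1 :: real) v = real_of_int (p + q + r)"
      "boundary D f v = of_int p + of_int q * (\<zeta> - 1) - of_int r * \<zeta>"
      using *[OF v] by blast
    then have "p + q + r = 3 * k" using k by linarith
    then have "p = k" "q = k" "r = k" using pqr(1,2) by linarith+
    then show "boundary D f v = 0" unfolding pqr(4) by (simp add: algebra_simps)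
  next
    fix v assume v: "v \<in> verts D" and k: "\<nexists>k :: int. boundary D (\<lambda>_. 1 :: real) v = 3 * real_of_int k"
    obtain p q r :: int where pqr: "\<bar>3 * p - (p + q + r)\<bar> < 3" "\<bar>q - r\<bar> \<le> 1"
      "boundary D (\<lambda>_. 1 :: real) v = real_of_int (p + q + r)"
      "boundary D f v = of_int p + of_int q * (\<zeta> - 1) - of_int r * \<zeta>"
      using *[OF v] by blast
    have "\<not> (q = p \<and> r = p)"
    proof
      assume "q = p \<and> r = p"
      then have "boundary D (\<lambda>_. 1 :: real) v = 3 * real_of_int p" using pqr(3) by simp
      then show False using k by blast
    qed
    then have "p\<^sup>2 + q\<^sup>2 + r\<^sup>2 - p * q - q * r - p * r = 1"
      using near_balanced_triple pqr(1,2) by blast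
    from norm_cube_root_combination_int[OF this] show "norm (boundary D f v) = 1"
      unfolding pqr(4) by simp
  qed
qed

text \<open>Here every boundary could be made zero, and the aim is to spoil it at two chosen
  vertices only. For a set \<open>M\<close> that takes exactly a third of every boundary, the saturated sets are unions of
  connected components, so \<open>w\<close> can be reached from \<open>u\<close> in the residual digraph, and one unit can be
  shifted from \<open>w\<close> to \<open>u\<close>. The three parts at \<open>u\<close> are then \<open>k + 1\<close>, \<open>k\<close> and \<open>k - 1\<close>
  in some order.\<close>

lemma sqrt3_boundary_at_two_vertices:
  assumes "fin_digraph D" "orientation_of D G"
    and div: "\<And>v. v \<in> verts D \<Longrightarrow> \<exists>k :: int. boundary D (\<lambda>_. 1 :: real) v = 3 * real_of_int k"
    and "u \<in> verts D" "w \<noteq> u" "(u, w) \<in> (adjacency G)\<^sup>*"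
  obtains f :: "'e \<Rightarrow> complex" and b where "\<And>e. norm (f e) = 1" "norm b = sqrt 3"
    and "boundary D f u = b" "boundary D f w = - b"
    and "\<And>v. v \<in> verts D \<Longrightarrow> v \<noteq> u \<Longrightarrow> v \<noteq> w \<Longrightarrow> boundary D f v = 0"
proof -
  interpret fin_digraph D by fact
  obtain M where M: "M \<subseteq> arcs D"
    "\<And>v. v \<in> verts D \<Longrightarrow> \<bar>boundary D (indicat_real M) v - 1/3 * boundary D (\<lambda>_. 1) v\<bar> < 1"
    using boundary_rounding[OF assms(1), of "1/3"] by auto
  have third: "boundary D (indicat_real M) v = 1/3 * boundary D (\<lambda>_. 1) v" if v: "v \<in> verts D" for v
  proof -
    obtain k :: int where k: "boundary D (\<lambda>_. 1 :: real) v = 3 * real_of_int k" using div[OF v] by blast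
    obtain p where p: "boundary D (indicat_real M) v = real_of_int p"
      by (rule boundary_indicator_int)
    show ?thesis using M(2)[OF v] unfolding k p by simp
  qed
  define S where "S = {v. u \<rightarrow>\<^sup>*\<^bsub>residual D M\<^esub> v}"
  interpret R: wf_digraph "residual D M" by (rule wf_residual) unfold_locales
  have SV: "S \<subseteq> verts D" using S_def R.reachable_in_verts(2) by fastforce
  have sum0: "(\<Sum>v\<in>S. boundary D (indicat_real M) v - 1/3 * boundary D (\<lambda>_. 1) v) = 0"
    using SV third by (intro sum.neutral) auto
  have closed: "tail D e \<in> S \<longleftrightarrow> head D e \<in> S" if "e \<in> arcs D" for e
    by (rule residual_reachable_excess(2)[OF assms(1) M(1) assms(4) _ _ S_def sum0 that]) auto
  from assms(6) have "w \<in> S"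
  proof (induction rule: rtrancl_induct)
    case base
    then show ?case using assms(4) by (simp add: S_def)
  next
    case (step x y)
    then obtain e where e: "e \<in> gedges G" "gends G e = {x, y}" by (auto simp: adjacency_def)
    then have "e \<in> arcs D" "{tail D e, head D e} = {x, y}"
      using assms(2) by (auto simp: orientation_of_def)
    then show ?case using closed[of e] step.IH by (auto simp: doubleton_eq_iff)
  qed
  then obtain M' where M': "M' \<subseteq> arcs D" "\<And>v. boundary D (indicat_real M') v =
    boundary D (indicat_real M) v + (if v = u then 1 else 0) - (if v = w then 1 else 0)"
    using residual_augment[OF assms(1) M(1), of u w] unfolding S_def by auto
  obtain f :: "'e \<Rightarrow> complex" where f: "\<And>e. norm (f e) = 1"
    and ex: "\<And>v. v \<in> verts D \<Longrightarrow> \<exists>p q r :: int. \<bar>q - r\<bar> \<le> 1 \<and>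
      boundary D (indicat_real M') v = real_of_int p \<and>
      boundary D (\<lambda>_. 1 :: real) v = real_of_int (p + q + r) \<and>
      boundary D f v = of_int p + of_int q * (\<zeta> - 1) - of_int r * \<zeta>"
    using cube_root_colouring[OF assms(1) M'(1)] by blast
  have *: "\<exists>p q r :: int. \<bar>q - r\<bar> \<le> 1 \<and> 3 * p = (p + q + r) + 3 * (if v = u then 1 else 0) - 3 * (if v = w then 1 else 0) \<and>
      boundary D f v = of_int p + of_int q * (\<zeta> - 1) - of_int r * \<zeta>"
    if v: "v \<in> verts D" for v
  proof -
    obtain p q r :: int where qr: "\<bar>q - r\<bar> \<le> 1" "boundary D (indicat_real M') v = real_of_int p"
      "boundary D (\<lambda>_. 1 :: real) v = real_of_int (p + q + r)"
      "boundary D f v = of_int p + of_int q * (\<zeta> - 1) - of_int r * \<zeta>"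
      using ex[OF v] by blast
    define t :: int where "t = (if v = u then 1 else 0) - (if v = w then 1 else 0)"
    have "boundary D (indicat_real M') v = boundary D (indicat_real M) v + real_of_int t"
      unfolding M'(2) t_def by simp
    then have "real_of_int (3 * p) = real_of_int (p + q + r + 3 * t)"
      using third[OF v] qr(2,3) unfolding of_int_diff of_int_add of_int_mult of_int_numeral
      by linarith
    then have "3 * p = p + q + r + 3 * t" by (simp only: of_int_eq_iff)
    then have "3 * p = (p + q + r) + 3 * (if v = u then 1 else 0) - 3 * (if v = w then 1 else 0)"
      by (simp add: t_def)
    then show ?thesis using qr(1,4) by blast
  qed
  have zero: "boundary D f v = 0" if v: "v \<in> verts D" "v \<noteq> u" "v \<noteq> w" for v
  proof -
    obtain p q r :: int where pqr: "\<bar>q - r\<bar> \<le> 1" "3 * p = p + q + r"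
      "boundary D f v = of_int p + of_int q * (\<zeta> - 1) - of_int r * \<zeta>"
      using *[OF v(1)] v(2,3) by auto
    have "q = p" "r = p" using pqr(1,2) by linarith+
    then show ?thesis unfolding pqr(3) by (simp add: algebra_simps)
  qed
  have "0 = (\<Sum>v\<in>verts D. boundary D f v)" using sum_boundary_verts[OF assms(1), of f] by simp
  also have "\<dots> = (\<Sum>v\<in>{u, w}. boundary D f v)"
    using zero assms(4) \<open>w \<in> S\<close> SV by (intro sum.mono_neutral_right) auto
  finally have w: "boundary D f w = - boundary D f u"
    using assms(5) by (simp add: add_eq_0_iff)
  obtain p q r :: int where pqr: "\<bar>q - r\<bar> \<le> 1" "3 * p = p + q + r + 3"
    "boundary D f u = of_int p + of_int q * (\<zeta> - 1) - of_int r * \<zeta>"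
    using *[OF assms(4)] assms(5) by auto
  have "p\<^sup>2 + q\<^sup>2 + r\<^sup>2 - p * q - q * r - p * r = 3"
    using unbalanced_triple pqr(1,2) by blast
  from norm_cube_root_combination_int[OF this] have "norm (boundary D f u) = sqrt 3"
    unfolding pqr(3) by simp
  then show ?thesis
    by (intro that[of f "boundary D f u"] f w zero) simp_all
qed

section \<open>Closing up around the rim of a wheel\<close>

text \<open>Orient the rim cyclically and the spokes towards the rim, and let \<open>x i\<close> be the value on the rim
  edge that leaves rim vertex \<open>i\<close>. If the edges outside the wheel have boundary \<open>\<beta> i\<close> at that vertex,
  conservation forces the value on its spoke, and the second condition says that this value is a unit
  vector.\<close>

definition closes_wheel :: "nat \<Rightarrow> (nat \<Rightarrow> complex) \<Rightarrow> (nat \<Rightarrow> complex) \<Rightarrow> bool" where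
  "closes_wheel n \<beta> x \<longleftrightarrow> (\<forall>i<n. norm (x i) = 1 \<and>
     norm (x (Suc i mod n) - x i + \<beta> (Suc i mod n)) = 1)"

text \<open>The wheel may be rotated, so a distinguished rim vertex can be taken to be vertex \<open>0\<close>.\<close>

lemma closes_wheel_rotate:
  assumes "j < n" "closes_wheel n (\<lambda>i. \<beta> ((i + j) mod n)) x"
  shows "closes_wheel n \<beta> (\<lambda>i. x ((i + (n - j)) mod n))"
  unfolding closes_wheel_def
proof (intro allI impI)
  fix i assume i: "i < n"
  define k where "k = (i + (n - j)) mod n"
  have k: "k < n" using i by (simp add: k_def)
  have 1: "(Suc i mod n + (n - j)) mod n = Suc k mod n"
    by (simp add: k_def mod_simps)
  have "(Suc k mod n + j) mod n = (Suc i + (n - j) + j) mod n"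
    by (simp add: k_def mod_simps)
  also have "Suc i + (n - j) + j = Suc i + n" using assms(1) by simp
  also have "(Suc i + n) mod n = Suc i mod n" by (rule mod_add_self2)
  finally have 2: "(Suc k mod n + j) mod n = Suc i mod n" .
  show "norm (x ((i + (n - j)) mod n)) = 1 \<and>
    norm (x ((Suc i mod n + (n - j)) mod n) - x ((i + (n - j)) mod n) + \<beta> (Suc i mod n)) = 1"
    using assms(2) k unfolding closes_wheel_def 1 k_def[symmetric] by (metis 2)
qed

lemma closes_wheelI:
  assumes "0 < n" "\<And>i. i < n \<Longrightarrow> norm (x i) = 1"
    and "\<And>i. Suc i < n \<Longrightarrow> norm (x (Suc i) - x i + \<beta> (Suc i)) = 1"
    and "norm (x 0 - x (n - 1) + \<beta> 0) = 1"
  shows "closes_wheel n \<beta> x"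
  unfolding closes_wheel_def
proof (intro allI impI)
  fix i assume i: "i < n"
  show "norm (x i) = 1 \<and> norm (x (Suc i mod n) - x i + \<beta> (Suc i mod n)) = 1"
  proof (cases "Suc i < n")
    case True
    then show ?thesis using assms(2)[OF i] assms(3)[OF True] by simp
  next
    case False
    then have "Suc i = n" "i = n - 1" using i by auto
    then show ?thesis using assms(2)[OF i] assms(4) by simp
  qed
qed

lemma add_mod_cancel:
  fixes i j n :: nat
  assumes "i < n" "i' < n" "(i + j) mod n = (i' + j) mod n"
  shows "i = i'"
proof -
  have "(int i + int j) mod int n = (int i' + int j) mod int n"
    using assms(3) by (metis of_nat_add of_nat_mod)
  then have "(int i + int j - int j) mod int n = (int i' + int j - int j) mod int n"
    by (rule mod_diff_cong) simp
  then show ?thesis using assms(1,2) by simp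
qed

lemma norm_zeta_step:
  assumes "norm z = 1"
  shows "norm (z * \<zeta> - z) = 1" "norm (z - z * \<zeta>) = 1"
proof -
  have "z * \<zeta> - z = z * (\<zeta> - 1)" by (simp add: algebra_simps)
  then show "norm (z * \<zeta> - z) = 1" using assms by (simp add: norm_mult)
  then show "norm (z - z * \<zeta>) = 1" by (simp add: norm_minus_commute)
qed

text \<open>Arriving at a vertex whose demand \<open>\<beta>\<close> is a unit vector, the sequence may jump to \<open>- \<beta>\<close> from
  anywhere: the spoke then carries minus the previous rim value. Starting with \<open>- \<beta>\<close> at such a vertex,
  it therefore closes up whatever the other steps do, as long as each of them is legal: a rotation by \<open>\<zeta>\<close>
  where the demand is zero, and no change where it is a unit vector.\<close>

lemma closes_wheel_unit:
  assumes "j < n" "norm (\<beta> j) = 1" "\<And>i. i < n \<Longrightarrow> \<beta> i = 0 \<or> norm (\<beta> i) = 1"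
  shows "\<exists>x. closes_wheel n \<beta> x"
proof -
  define \<gamma> where "\<gamma> i = \<beta> ((i + j) mod n)" for i
  have \<gamma>0: "norm (\<gamma> 0) = 1" using assms by (simp add: \<gamma>_def)
  have \<gamma>: "\<gamma> i = 0 \<or> norm (\<gamma> i) = 1" for i using assms by (simp add: \<gamma>_def)
  define x where "x i = - \<gamma> 0 * (\<Prod>k\<in>{1..i}. if \<gamma> k = 0 then \<zeta> else 1)" for i
  have Suc: "x (Suc i) = x i * (if \<gamma> (Suc i) = 0 then \<zeta> else 1)" for i
    by (simp add: x_def)
  have x: "norm (x i) = 1" for i
    by (induction i) (auto simp: Suc norm_mult \<gamma>0, simp add: x_def \<gamma>0)
  have "closes_wheel n \<gamma> x"
  proof (rule closes_wheelI)
    show "norm (x (Suc i) - x i + \<gamma> (Suc i)) = 1" for i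
      using \<gamma>[of "Suc i"] norm_zeta_step[OF x[of i]] by (auto simp: Suc)
    show "norm (x 0 - x (n - 1) + \<gamma> 0) = 1"
      using x[of "n - 1"] by (simp add: x_def)
  qed (use assms x in auto)
  then show ?thesis using closes_wheel_rotate[OF assms(1)] unfolding \<gamma>_def by blast
qed

lemma closes_wheel_even:
  assumes "even n" "0 < n" "\<And>i. i < n \<Longrightarrow> \<beta> i = 0"
  shows "\<exists>x. closes_wheel n \<beta> x"
proof -
  have "closes_wheel n \<beta> (\<lambda>i. if even i then 1 else \<zeta>)"
    by (rule closes_wheelI) (use assms norm_zeta_step[of 1] in auto)
  then show ?thesis by blast
qed

text \<open>The isosceles triangle with sides \<open>sqrt 3\<close>, \<open>sqrt 3\<close> and \<open>1\<close>. At the apex its cosine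
  is \<open>(3 + 3 - 1) / 6\<close>.\<close>

lemma sqrt3_isosceles:
  assumes "norm (b :: complex) = sqrt 3"
  obtains p where "norm p = sqrt 3" "norm (p - b) = 1"
proof (rule that)
  \<comment> \<open>the unit vector at the apex angle from the positive real axis\<close>
  define c where "c = Complex (5/6) (sqrt 11 / 6)"
  have "norm c = 1" "norm (c - 1) = 1 / sqrt 3"
    by (simp_all add: c_def cmod_def power_divide real_sqrt_divide)
  moreover have "b * c - b = b * (c - 1)" by (simp add: algebra_simps)
  ultimately show "norm (b * c) = sqrt 3" "norm (b * c - b) = 1"
    using assms by (simp_all add: norm_mult)
qed

text \<open>The zero demands turn the rim value by \<open>\<zeta>\<close> back and forth. Since they are even in number and at
  least two, they can produce a total turn by \<open>\<zeta>\<^sup>2\<close>, a displacement of length \<open>sqrt 3\<close>. The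
  starting value \<open>a\<close> is chosen so that this displacement, taken backwards, differs from minus the
  demand, a vector of the same length, by a unit vector.\<close>

lemma closes_wheel_one_sqrt3:
  assumes "odd n" "n \<ge> 3" "j < n" "norm (\<beta> j) = sqrt 3" "\<And>i. i < n \<Longrightarrow> i \<noteq> j \<Longrightarrow> \<beta> i = 0"
  shows "\<exists>x. closes_wheel n \<beta> x"
proof -
  define \<gamma> where "\<gamma> i = \<beta> ((i + j) mod n)" for i
  have \<gamma>0: "norm (\<gamma> 0) = sqrt 3" using assms by (simp add: \<gamma>_def)
  have \<gamma>: "\<gamma> i = 0" if "0 < i" "i < n" for i
  proof -
    have "(i + j) mod n \<noteq> j"
      using add_mod_cancel[of i n 0 j] that assms by auto
    then show ?thesis using assms(5) that by (simp add: \<gamma>_def)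
  qed
  obtain p where p: "norm p = sqrt 3" "norm (p - \<gamma> 0) = 1" using sqrt3_isosceles[OF \<gamma>0] .
  define a where "a = - p / (1 - \<zeta>\<^sup>2)"
  have ne: "1 - \<zeta>\<^sup>2 \<noteq> 0" using norm_one_minus_zeta_square by force
  have a: "norm a = 1" using p by (simp add: a_def norm_divide norm_one_minus_zeta_square)
  define x where "x i = (if i = 0 then a else if odd i then a * \<zeta> else a * \<zeta>\<^sup>2)" for i :: nat
  have "closes_wheel n \<gamma> x"
  proof (rule closes_wheelI)
    show "norm (x i) = 1" for i by (simp add: x_def a norm_mult norm_power)
    show "norm (x (Suc i) - x i + \<gamma> (Suc i)) = 1" if "Suc i < n" for i
      using \<gamma>[of "Suc i"] that norm_zeta_step[OF a] norm_zeta_step[of "a * \<zeta>"]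
      by (auto simp: x_def a norm_mult power2_eq_square mult.assoc)
    have "x 0 - x (n - 1) = a * (1 - \<zeta>\<^sup>2)" using assms(1,2) by (simp add: x_def algebra_simps)
    also have "\<dots> = - p" using ne by (simp add: a_def)
    finally show "norm (x 0 - x (n - 1) + \<gamma> 0) = 1" using p(2) by (simp add: norm_minus_commute)
  qed (use assms in auto)
  then show ?thesis using closes_wheel_rotate[OF assms(3)] unfolding \<gamma>_def by blast
qed

text \<open>The two distinguished vertices cut the rim into two stretches of zero demands, one even in number
  and one odd. Along the even stretch the value ends where it began, at a vector \<open>c\<close>; along the odd one it
  is turned by \<open>\<zeta>\<close>. For both transitions it suffices that the two values at the ends of the odd stretch
  add up to \<open>c \<plusminus> b\<close>. Two unit vectors at an angle of sixty degrees have a sum of length \<open>sqrt 3\<close>,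
  so this asks for a unit vector \<open>c\<close> with \<open>norm (c \<plusminus> b) = sqrt 3\<close>, and an isosceles triangle
  supplies it.\<close>

lemma closes_wheel_two_sqrt3:
  assumes "odd n" "j < n" "k < n" "j \<noteq> k" "norm (\<beta> j) = sqrt 3" "\<beta> k = - \<beta> j"
    and "\<And>i. i < n \<Longrightarrow> i \<noteq> j \<Longrightarrow> i \<noteq> k \<Longrightarrow> \<beta> i = 0"
  shows "\<exists>x. closes_wheel n \<beta> x"
proof -
  define \<gamma> where "\<gamma> i = \<beta> ((i + j) mod n)" for i
  define b where "b = \<gamma> 0"
  define m where "m = (k + (n - j)) mod n"
  have b: "norm b = sqrt 3" using assms by (simp add: b_def \<gamma>_def)
  have mj: "(m + j) mod n = k" using assms by (simp add: m_def mod_simps)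
  have "m \<noteq> 0" using mj assms(2,4) by (intro notI) simp
  have "m < n" using assms by (simp add: m_def)
  have \<gamma>m: "\<gamma> m = - b" using assms mj by (simp add: b_def \<gamma>_def)
  have \<gamma>: "\<gamma> i = 0" if "0 < i" "i < n" "i \<noteq> m" for i
  proof -
    have "(i + j) mod n \<noteq> j" using add_mod_cancel[of i n 0 j] that assms by auto
    moreover have "(i + j) mod n \<noteq> k" using add_mod_cancel[of i n m j] that mj \<open>m < n\<close> by auto
    ultimately show ?thesis using assms(7) that by (simp add: \<gamma>_def)
  qed
  obtain p where p: "norm p = sqrt 3" "norm (p - b) = 1" using sqrt3_isosceles[OF b] .
  have ne: "1 + \<zeta> \<noteq> 0" using norm_zeta_plus_1 by force
  have "\<exists>x. closes_wheel n \<gamma> x"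
  proof (cases "odd m")
    case True
    \<comment> \<open>\<open>m - 1\<close> zero demands before vertex \<open>m\<close>, an even number: the value is back at \<open>c\<close>.\<close>
    define c z where "c = p - b" and "z = p / (1 + \<zeta>)"
    have c: "norm c = 1" and z: "norm z = 1"
      using p by (simp_all add: c_def z_def norm_divide norm_zeta_plus_1)
    have "z + z * \<zeta> = z * (1 + \<zeta>)" by (simp add: algebra_simps)
    also have "\<dots> = c + b" using ne by (simp add: c_def z_def)
    finally have "c + b = z + z * \<zeta>" by simp
    then have cb: "c - z * \<zeta> + b = z" "z - c - b = - (z * \<zeta>)" by (simp_all add: algebra_simps)
    define x where "x i = (if i < m then if even i then c else c * \<zeta> else if even (i - m) then z else z * \<zeta>)" for i
    have "closes_wheel n \<gamma> x"
    proof (rule closes_wheelI)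
      show "norm (x i) = 1" for i by (simp add: x_def c z norm_mult)
      show "norm (x (Suc i) - x i + \<gamma> (Suc i)) = 1" if i: "Suc i < n" for i
      proof -
        consider "Suc i < m" | "Suc i = m" | "m < Suc i" by linarith
        then show ?thesis
        proof cases
          case 1 then show ?thesis using \<gamma>[of "Suc i"] i norm_zeta_step[OF c] by (simp add: x_def)
        next
          case 2 then show ?thesis using True cb(2) z by (auto simp: x_def \<gamma>m norm_mult)
        next
          case 3 then show ?thesis using \<gamma>[of "Suc i"] i norm_zeta_step[OF z] by (simp add: x_def Suc_diff_le)
        qed
      qed
      show "norm (x 0 - x (n - 1) + \<gamma> 0) = 1"
        using \<open>m \<noteq> 0\<close> \<open>m < n\<close> True assms(1) cb(1) z by (auto simp: x_def b_def[symmetric])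
    qed (use assms in auto)
    then show ?thesis by blast
  next
    case False
    \<comment> \<open>Here the stretch after vertex \<open>m\<close> is the even one.\<close>
    define c y where "c = b - p" and "y = - p / (1 + \<zeta>)"
    have c: "norm c = 1" and y: "norm y = 1"
      using p by (simp_all add: c_def y_def norm_divide norm_zeta_plus_1 norm_minus_commute)
    have "y + y * \<zeta> = y * (1 + \<zeta>)" by (simp add: algebra_simps)
    also have "\<dots> = c - b" using ne by (simp add: c_def y_def)
    finally have "c - b = y + y * \<zeta>" by simp
    then have cb: "y - c + b = - (y * \<zeta>)" "c - y * \<zeta> - b = y" by (simp_all add: algebra_simps)
    define x where "x i = (if i < m then if even i then y else y * \<zeta> else if even (i - m) then c else c * \<zeta>)" for i
    have "closes_wheel n \<gamma> x"
    proof (rule closes_wheelI)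
      show "norm (x i) = 1" for i by (simp add: x_def c y norm_mult)
      show "norm (x (Suc i) - x i + \<gamma> (Suc i)) = 1" if i: "Suc i < n" for i
      proof -
        consider "Suc i < m" | "Suc i = m" | "m < Suc i" by linarith
        then show ?thesis
        proof cases
          case 1 then show ?thesis using \<gamma>[of "Suc i"] i norm_zeta_step[OF y] by (simp add: x_def)
        next
          case 2 then show ?thesis using False cb(2) y by (auto simp: x_def \<gamma>m)
        next
          case 3 then show ?thesis using \<gamma>[of "Suc i"] i norm_zeta_step[OF c] by (simp add: x_def Suc_diff_le)
        qed
      qed
      show "norm (x 0 - x (n - 1) + \<gamma> 0) = 1"
        using \<open>m \<noteq> 0\<close> \<open>m < n\<close> False assms(1) cb(1) y by (auto simp: x_def b_def[symmetric] norm_mult)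
    qed (use assms in auto)
    then show ?thesis by blast
  qed
  then show ?thesis using closes_wheel_rotate[OF assms(2)] unfolding \<gamma>_def by blast
qed

section \<open>From the contraction to an orientation\<close>

lemma fin_digraph_orientation:
  assumes "finite_mgraph G" "orientation_of D G"
  shows "fin_digraph D"
proof
  fix e assume "e \<in> arcs D"
  then have "gends G e = {tail D e, head D e}" "gends G e \<subseteq> verts D"
    using assms by (auto simp: finite_mgraph_def orientation_of_def)
  then show "tail D e \<in> verts D" "head D e \<in> verts D" by auto
qed (use assms in \<open>auto simp: finite_mgraph_def orientation_of_def\<close>)

lemma contraction_class_outside:
  assumes "subgraph_of H G" "v \<in> gverts G - gverts H" "u \<in> gverts G"
  shows "contraction_class G H u = {v} \<longleftrightarrow> u = v"
proof -
  have "adjacency H \<subseteq> gverts H \<times> gverts H"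
    using assms(1) unfolding adjacency_def subgraph_of_def finite_mgraph_def by fastforce
  then have "x = v" if "(v, x) \<in> (adjacency H)\<^sup>*" for x
    using that assms(2) by (auto elim: converse_rtranclE)
  then have "contraction_class G H v = {v}"
    using assms(2) by (auto simp: contraction_class_def)
  moreover have "u \<in> contraction_class G H u"
    using assms(3) by (simp add: contraction_class_def)
  ultimately show ?thesis by auto
qed

text \<open>Reverse the edges whose value in the 3-flow is \<open>-1\<close> or \<open>2\<close>. Then all values are congruent
  to \<open>1\<close> modulo three, and conservation of the flow modulo three becomes divisibility of out-degree minus
  in-degree. A vertex outside \<open>H\<close> is not merged with any other, so all its edges survive the
  contraction.\<close>

lemma orientation_from_contraction:
  assumes "finite_mgraph G" "subgraph_of H G" "admits_nowhere_zero_3_flow (contract G H)"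
  obtains D where "orientation_of D G"
    and "\<And>v. v \<in> gverts G - gverts H \<Longrightarrow> \<exists>k :: int. boundary D (\<lambda>_. 1 :: real) v = 3 * real_of_int k"
proof -
  let ?cls = "contraction_class G H"
  define K where "K = gedges (contract G H)"
  have K: "e \<in> K \<longleftrightarrow> e \<in> gedges G \<and> card (?cls ` gends G e) = 2" for e
    by (auto simp: K_def contract_def)
  obtain D0 and f0 :: "'b \<Rightarrow> real" where flow: "is_flow {1, -1, 2, -2} (contract G H) D0 f0"
    using assms(3) by (auto simp: admits_nowhere_zero_3_flow_def admits_flow_def)
  have ends0: "?cls ` gends G e = {tail D0 e, head D0 e}" if "e \<in> K" for e
    using flow that by (auto simp: is_flow_def orientation_of_def K_def contract_def)
  have f0: "f0 e \<in> {1, -1, 2, -2}" if "e \<in> K" for e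
    using flow that by (auto simp: is_flow_def K_def)
  have arcs0: "arcs D0 = K" using flow by (simp add: is_flow_def orientation_of_def K_def)
  have finG: "finite (gedges G)" using assms(1) by (simp add: finite_mgraph_def)
  have KG: "K \<subseteq> gedges G" using K by blast
  have finK: "finite K" using finG KG finite_subset by blast
  \<comment> \<open>the class in which the edge starts after the reversals\<close>
  define T where "T e = (if f0 e \<in> {1, -2} then tail D0 e else head D0 e)" for e
  have "\<exists>a b. gends G e = {a, b} \<and> (e \<in> K \<longrightarrow> ?cls a = T e)" if e: "e \<in> gedges G" for e
  proof -
    obtain x y where xy: "gends G e = {x, y}"
      using assms(1) e by (auto simp: finite_mgraph_def card_2_iff)
    show ?thesis
    proof (cases "e \<in> K \<and> ?cls x \<noteq> T e")
      case True
      then have "?cls y = T e" using ends0[of e] xy by (auto simp: T_def doubleton_eq_iff)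
      then show ?thesis using xy by (intro exI[of _ y] exI[of _ x]) auto
    next
      case False
      then show ?thesis using xy by blast
    qed
  qed
  then obtain t h where th: "\<And>e. e \<in> gedges G \<Longrightarrow> gends G e = {t e, h e}"
    and T: "\<And>e. e \<in> K \<Longrightarrow> ?cls (t e) = T e"
    using KG by (metis subsetD)
  define D where "D = \<lparr>verts = gverts G, arcs = gedges G, tail = t, head = h\<rparr>"
  show ?thesis
  proof (rule that[of D])
    show "orientation_of D G" using th by (simp add: D_def orientation_of_def)
    fix v assume v: "v \<in> gverts G - gverts H"
    have inG: "t e \<in> gverts G" "h e \<in> gverts G" if "e \<in> gedges G" for e
      using th[OF that] that assms(1) by (auto simp: finite_mgraph_def)
    note cls_v = contraction_class_outside[OF assms(2) v]
    \<comment> \<open>the contributions of an edge at \<open>v\<close> in the new orientation and in the 3-flow\<close>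
    define a where "a e = (if t e = v then 1 else 0) - (if h e = v then 1 else 0 :: int)" for e
    define g where "g e = (if tail D0 e = {v} then f0 e else 0) - (if head D0 e = {v} then f0 e else 0)" for e
    have g: "real_of_int (a e) - g e = 3 * real_of_int (if f0 e \<in> {2, -2} then a e else 0)" if e: "e \<in> K" for e
    proof -
      have eG: "e \<in> gedges G" using e KG by blast
      have ends: "{?cls (t e), ?cls (h e)} = {tail D0 e, head D0 e}" "card {tail D0 e, head D0 e} = 2"
        using ends0[OF e] th[OF eG] K e by auto
      have a_eq: "a e = (if ?cls (t e) = {v} then 1 else 0) - (if ?cls (h e) = {v} then 1 else 0)"
        using cls_v inG[OF eG] by (simp add: a_def)
      show ?thesis
      proof (cases "f0 e \<in> {1, -2}")
        case True
        then have "?cls (t e) = tail D0 e" "?cls (h e) = head D0 e"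
          using T[OF e] ends by (auto simp: T_def doubleton_eq_iff)
        then show ?thesis using True unfolding a_eq g_def by auto
      next
        case False
        then have "?cls (t e) = head D0 e" "?cls (h e) = tail D0 e"
          using T[OF e] ends by (auto simp: T_def doubleton_eq_iff)
        moreover have "f0 e \<in> {-1, 2}" using False f0[OF e] by blast
        ultimately show ?thesis unfolding a_eq g_def by auto
      qed
    qed
    \<comment> \<open>The edges deleted by the contraction do not meet \<open>v\<close>.\<close>
    have a0: "a e = 0" if e: "e \<in> gedges G - K" for e
    proof -
      have "card {?cls (t e), ?cls (h e)} \<noteq> 2" using e K th by fastforce
      then have "?cls (t e) = ?cls (h e)" by (auto simp: card_2_iff)
      moreover have "e \<in> gedges G" using e by blast
      ultimately have "t e = v \<longleftrightarrow> h e = v" using cls_v inG by metis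
      then show ?thesis by (simp add: a_def)
    qed
    have "{v} \<in> gverts (contract G H)"
      using cls_v[of v] v by (auto simp: contract_def image_iff intro!: bexI[of _ v])
    then have "boundary D0 f0 {v} = 0" using flow by (simp add: is_flow_def)
    then have 0: "(\<Sum>e\<in>K. g e) = 0"
      using boundary_eq_sum[of D0 f0 "{v}"] finK unfolding arcs0 g_def by simp
    have "boundary D (\<lambda>_. 1 :: real) v = (\<Sum>e\<in>gedges G. real_of_int (a e))"
      using boundary_eq_sum[of D "\<lambda>_. 1 :: real" v] finG by (auto simp: D_def a_def intro!: sum.cong)
    also have "\<dots> = (\<Sum>e\<in>K. real_of_int (a e))"
      using finG KG a0 by (intro sum.mono_neutral_right) auto
    also have "\<dots> = (\<Sum>e\<in>K. real_of_int (a e) - g e)" using 0 by (simp add: sum_subtractf)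
    also have "\<dots> = (\<Sum>e\<in>K. 3 * real_of_int (if f0 e \<in> {2, -2} then a e else 0))"
      using g by (rule sum.cong[OF refl])
    also have "\<dots> = 3 * real_of_int (\<Sum>e\<in>K. if f0 e \<in> {2, -2} then a e else 0)"
      unfolding of_int_sum sum_distrib_left ..
    finally show "\<exists>k :: int. boundary D (\<lambda>_. 1 :: real) v = 3 * real_of_int k" by blast
  qed
qed

lemma sym_adjacency: "sym (adjacency G)"
  by (auto simp: sym_def adjacency_def insert_commute)

text \<open>If \<open>H\<close> is spanning, any edge outside \<open>H\<close> will do. Otherwise there is a vertex \<open>z\<close>
  outside \<open>H\<close>; if the edges not in \<open>H\<close> led from \<open>z\<close> to only one vertex of \<open>H\<close>,
  that vertex would separate \<open>z\<close> from the rest of \<open>H\<close>.\<close>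

lemma two_attached_vertices:
  assumes "finite_mgraph G" "k_connected 2 G" "proper_subgraph_of H G"
    and "x \<in> gverts H" "y \<in> gverts H" "x \<noteq> y"
  obtains u w where "u \<in> gverts H" "w \<in> gverts H" "u \<noteq> w"
    "(u, w) \<in> (adjacency (G\<lparr>gedges := gedges G - gedges H\<rparr>))\<^sup>*"
proof (cases "gverts H = gverts G")
  case True
  then obtain e where e: "e \<in> gedges G - gedges H"
    using assms(3) by (auto simp: proper_subgraph_of_def subgraph_of_def)
  then obtain a b where ab: "gends G e = {a, b}" "a \<noteq> b" "a \<in> gverts G" "b \<in> gverts G"
    using assms(1) by (auto simp: finite_mgraph_def card_2_iff)
  then have "(a, b) \<in> adjacency (G\<lparr>gedges := gedges G - gedges H\<rparr>)"
    using e by (auto simp: adjacency_def)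
  then show ?thesis using that[of a b] ab True by blast
next
  case False
  let ?R = "adjacency (G\<lparr>gedges := gedges G - gedges H\<rparr>)"
  have sub: "subgraph_of H G" using assms(3) by (simp add: proper_subgraph_of_def)
  then obtain z where z: "z \<in> gverts G" "z \<notin> gverts H"
    using False by (auto simp: subgraph_of_def)
  note found = that
  show ?thesis
  proof (rule ccontr)
    assume none: "\<not> thesis"
    have unique: "u = w" if "u \<in> gverts H" "w \<in> gverts H" "(z, u) \<in> ?R\<^sup>*" "(z, w) \<in> ?R\<^sup>*" for u w
    proof -
      have "(u, z) \<in> ?R\<^sup>*" using that(3) sym_rtrancl[OF sym_adjacency] by (meson symD)
      then have "(u, w) \<in> ?R\<^sup>*" using that(4) by (rule rtrancl_trans)
      then show ?thesis using none found that(1,2) by blast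
    qed
    obtain u where u: "u \<in> gverts H" "\<And>w. w \<in> gverts H \<Longrightarrow> (z, w) \<in> ?R\<^sup>* \<Longrightarrow> w = u"
      using unique assms(4) by metis
    obtain y' where y': "y' \<in> gverts H" "y' \<noteq> u" using assms(4-6) by metis
    have HG: "gverts H \<subseteq> gverts G" using sub by (simp add: subgraph_of_def)
    have "connected_mgraph (delete_verts G {u})"
      using assms(2) u(1) HG by (auto simp: k_connected_def)
    then have "(z, y') \<in> (adjacency (delete_verts G {u}))\<^sup>*"
      using z y' HG u(1) by (auto simp: connected_mgraph_def delete_verts_def)
    then have "(z, y') \<in> ?R\<^sup>*"
    proof (induction rule: rtrancl_induct)
      case (step a b)
      then obtain e where e: "e \<in> gedges G" "gends G e = {a, b}" "a \<noteq> u"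
        by (auto simp: adjacency_def delete_verts_def)
      have "a \<notin> gverts H" using u(2) step.IH e(3) by blast
      then have "e \<notin> gedges H"
        using sub e(2) unfolding subgraph_of_def finite_mgraph_def by (metis insert_subset)
      then have "(a, b) \<in> ?R" using e by (auto simp: adjacency_def)
      then show ?case using step.IH by (rule rtrancl_into_rtrancl[rotated])
    qed simp
    then show False using u(2) y' by blast
  qed
qed

section \<open>Extending a flow over the wheel\<close>

text \<open>The bound \<open>n \<ge> 3\<close> makes the rim edges distinct: for \<open>n = 2\<close> both would have the ends \<open>r 0\<close> and
  \<open>r 1\<close>.\<close>

lemma wheel_labelling:
  assumes "n \<ge> 3" "finite_mgraph H" "isomorphic_mgraph H (wheel_graph n)"
  obtains r c \<rho> \<sigma> where "inj_on r {..<n}" "c \<notin> r ` {..<n}" "gverts H = insert c (r ` {..<n})"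
    and "inj_on \<rho> {..<n}" "inj_on \<sigma> {..<n}" "\<rho> ` {..<n} \<inter> \<sigma> ` {..<n} = {}"
    and "gedges H = \<rho> ` {..<n} \<union> \<sigma> ` {..<n}"
    and "\<And>i. i < n \<Longrightarrow> gends H (\<rho> i) = {r i, r (Suc i mod n)}"
    and "\<And>i. i < n \<Longrightarrow> gends H (\<sigma> i) = {c, r i}"
proof -
  let ?W = "wheel_graph n" and ?I = "{..<n}"
  obtain \<phi> \<psi> where \<phi>: "bij_betw \<phi> (gverts H) (gverts ?W)" and \<psi>: "bij_betw \<psi> (gedges H) (gedges ?W)"
    and ends: "\<And>e. e \<in> gedges H \<Longrightarrow> \<psi> e = \<phi> ` gends H e"
    using assms(3) by (auto simp: isomorphic_mgraph_def wheel_graph_def)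
  define \<phi>' where "\<phi>' = inv_into (gverts H) \<phi>"
  define \<psi>' where "\<psi>' = inv_into (gedges H) \<psi>"
  define rim spoke where "rim i = {i, Suc i mod n}" and "spoke i = {n, i}" for i
  have VW: "gverts ?W = insert n ?I" and EW: "gedges ?W = rim ` ?I \<union> spoke ` ?I"
    by (auto simp: wheel_graph_def cycle_graph_def rim_def spoke_def)
  have \<phi>': "bij_betw \<phi>' (insert n ?I) (gverts H)"
    unfolding \<phi>'_def VW[symmetric] by (rule bij_betw_inv_into[OF \<phi>])
  have \<psi>': "bij_betw \<psi>' (rim ` ?I \<union> spoke ` ?I) (gedges H)"
    unfolding \<psi>'_def EW[symmetric] by (rule bij_betw_inv_into[OF \<psi>])
  have ends': "gends H (\<psi>' s) = \<phi>' ` s" if "s \<in> rim ` ?I \<union> spoke ` ?I" for s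
  proof -
    have e: "\<psi>' s \<in> gedges H" using \<psi>' that by (rule bij_betwE[rule_format])
    have "s = \<psi> (\<psi>' s)" unfolding \<psi>'_def
      using bij_betw_inv_into_right[OF \<psi>] that EW by simp
    also have "\<dots> = \<phi> ` gends H (\<psi>' s)" by (rule ends[OF e])
    finally have "\<phi>' ` s = \<phi>' ` \<phi> ` gends H (\<psi>' s)" by simp
    moreover have "gends H (\<psi>' s) \<subseteq> gverts H" using e assms(2) by (simp add: finite_mgraph_def)
    ultimately show ?thesis unfolding \<phi>'_def using \<phi> by (simp add: bij_betw_def inv_into_image_cancel)
  qed
  have rim_less: "rim i \<subseteq> ?I" if "i < n" for i using that by (auto simp: rim_def)
  have inj_rim: "inj_on rim ?I"
  proof (rule inj_onI)
    fix i j assume ij: "i \<in> ?I" "j \<in> ?I" "rim i = rim j"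
    have suc: "Suc k mod n = (if Suc k = n then 0 else Suc k)" if "k < n" for k
      using that by (simp add: mod_Suc)
    show "i = j" using ij assms(1) suc[of i] suc[of j]
      by (auto simp: rim_def doubleton_eq_iff split: if_splits)
  qed
  have inj_spoke: "inj_on spoke ?I" by (auto simp: inj_on_def spoke_def doubleton_eq_iff)
  have disj: "rim ` ?I \<inter> spoke ` ?I = {}" using rim_less by (fastforce simp: spoke_def)
  have inj\<psi>: "inj_on \<psi>' (rim ` ?I \<union> spoke ` ?I)" using \<psi>' by (simp add: bij_betw_def)
  show ?thesis
  proof (rule that[of \<phi>' "\<phi>' n" "\<psi>' \<circ> rim" "\<psi>' \<circ> spoke"])
    show "inj_on \<phi>' ?I" using \<phi>' by (auto simp: bij_betw_def)
    show "\<phi>' n \<notin> \<phi>' ` ?I" using \<phi>' by (auto simp: bij_betw_def inj_on_def)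
    show "gverts H = insert (\<phi>' n) (\<phi>' ` ?I)" using \<phi>' by (auto simp: bij_betw_def)
    show "inj_on (\<psi>' \<circ> rim) ?I"
      by (rule comp_inj_on[OF inj_rim inj_on_subset[OF inj\<psi>]]) simp
    show "inj_on (\<psi>' \<circ> spoke) ?I"
      by (rule comp_inj_on[OF inj_spoke inj_on_subset[OF inj\<psi>]]) simp
    show "(\<psi>' \<circ> rim) ` ?I \<inter> (\<psi>' \<circ> spoke) ` ?I = {}"
      unfolding image_comp[symmetric] using inj_on_image_Int[OF inj\<psi>, of "rim ` ?I" "spoke ` ?I"] disj by simp
    show "gedges H = (\<psi>' \<circ> rim) ` ?I \<union> (\<psi>' \<circ> spoke) ` ?I"
      using \<psi>' by (auto simp: bij_betw_def image_Un image_comp)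
    show "gends H ((\<psi>' \<circ> rim) i) = {\<phi>' i, \<phi>' (Suc i mod n)}" if "i < n" for i
      using ends'[of "rim i"] that by (simp add: rim_def)
    show "gends H ((\<psi>' \<circ> spoke) i) = {\<phi>' n, \<phi>' i}" if "i < n" for i
      using ends'[of "spoke i"] that by (simp add: spoke_def)
  qed
qed

lemma admits_S1_flow_complex:
  assumes "orientation_of D G" "\<And>e. e \<in> gedges G \<Longrightarrow> norm (F e) = 1"
    and "\<And>v. v \<in> gverts G \<Longrightarrow> boundary D F v = (0 :: complex)"
  shows "admits_S1_flow G"
proof -
  define L :: "complex \<Rightarrow> real ^ 2" where "L z = vector [Re z, Im z]" for z
  have L: "linear L"
    by (auto simp: linear_iff L_def vec_eq_iff forall_2)
  have "norm (L z) = norm z" for z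
    by (simp add: L_def norm_vec_def L2_set_def UNIV_2 cmod_def)
  then have "is_flow {x :: real ^ 2. norm x = 1} G D (\<lambda>e. L (F e))"
    using assms boundary_linear[OF L, of D F] linear_0[OF L] by (simp add: is_flow_def)
  then show ?thesis by (auto simp: admits_S1_flow_def admits_flow_def)
qed

text \<open>Rim edges take the values \<open>x\<close>, spokes the values that conservation at the rim dictates. The hub
  takes care of itself, because the boundaries of all vertices add up to zero.\<close>

lemma extend_over_wheel:
  fixes f :: "'e \<Rightarrow> complex"
  assumes "finite_mgraph G" "subgraph_of H G" "n \<ge> 3"
    and r: "inj_on r {..<n}" "c \<notin> r ` {..<n}" "gverts H = insert c (r ` {..<n})"
    and \<rho>\<sigma>: "inj_on \<rho> {..<n}" "inj_on \<sigma> {..<n}" "\<rho> ` {..<n} \<inter> \<sigma> ` {..<n} = {}"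
    and E: "gedges H = \<rho> ` {..<n} \<union> \<sigma> ` {..<n}"
    and rim: "\<And>i. i < n \<Longrightarrow> gends H (\<rho> i) = {r i, r (Suc i mod n)}"
    and spoke: "\<And>i. i < n \<Longrightarrow> gends H (\<sigma> i) = {c, r i}"
    and D: "orientation_of D (G\<lparr>gedges := gedges G - gedges H\<rparr>)"
    and f: "\<And>e. norm (f e) = 1" "\<And>v. v \<in> gverts G - gverts H \<Longrightarrow> boundary D f v = 0"
    and x: "closes_wheel n (\<lambda>i. boundary D f (r i)) x"
  shows "admits_S1_flow G"
proof -
  let ?I = "{..<n}"
  define pred where "pred j = (if j = 0 then n - 1 else j - 1)" for j
  have pred: "i = pred j \<longleftrightarrow> Suc i mod n = j" if "i < n" "j < n" for i j
    using that by (auto simp: pred_def mod_Suc)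
  have pred_less: "pred j < n" if "j < n" for j using that by (auto simp: pred_def)
  define s where "s j = x j - x (pred j) + boundary D f (r j)" for j
  have x1: "norm (x i) = 1" if "i < n" for i using x that by (simp add: closes_wheel_def)
  have s1: "norm (s j) = 1" if "j < n" for j
    using x pred_less[OF that] pred[OF pred_less[OF that] that] by (auto simp: closes_wheel_def s_def)
  define \<rho>' \<sigma>' where "\<rho>' = inv_into ?I \<rho>" and "\<sigma>' = inv_into ?I \<sigma>"
  have \<rho>': "\<rho>' (\<rho> i) = i" and \<sigma>': "\<sigma>' (\<sigma> i) = i" if "i < n" for i
    using that \<rho>\<sigma> by (auto simp: \<rho>'_def \<sigma>'_def)
  define D' where "D' = \<lparr>verts = gverts G, arcs = gedges G,
    tail = \<lambda>e. if e \<in> \<rho> ` ?I then r (\<rho>' e) else if e \<in> \<sigma> ` ?I then c else tail D e,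
    head = \<lambda>e. if e \<in> \<rho> ` ?I then r (Suc (\<rho>' e) mod n) else if e \<in> \<sigma> ` ?I then r (\<sigma>' e) else head D e\<rparr>"
  define F where "F e = (if e \<in> \<rho> ` ?I then x (\<rho>' e) else if e \<in> \<sigma> ` ?I then s (\<sigma>' e) else f e)" for e
  have HG: "gedges H \<subseteq> gedges G" "gverts H \<subseteq> gverts G" "\<And>e. e \<in> gedges H \<Longrightarrow> gends G e = gends H e"
    using assms(2) by (auto simp: subgraph_of_def)
  have finG: "finite (gedges G)" using assms(1) by (simp add: finite_mgraph_def)
  have not_rim: "\<sigma> i \<notin> \<rho> ` ?I" if "i < n" for i using \<rho>\<sigma>(3) that by blast
  have D': "orientation_of D' G"
    unfolding orientation_of_def
  proof (intro conjI ballI)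
    fix e assume e: "e \<in> gedges G"
    consider i where "i < n" "e = \<rho> i" | i where "i < n" "e = \<sigma> i" | "e \<notin> gedges H" using E by blast
    then show "gends G e = {tail D' e, head D' e}"
    proof cases
      case 1 then show ?thesis using HG(3)[of e] E rim by (auto simp: D'_def \<rho>')
    next
      case 2 then show ?thesis using HG(3)[of e] E spoke not_rim by (simp add: D'_def \<sigma>')
    next
      case 3 then show ?thesis using D E e by (simp add: D'_def orientation_of_def)
    qed
  qed (simp_all add: D'_def)
  have fin: "fin_digraph D'" using fin_digraph_orientation[OF assms(1) D'] .
  have arcsD: "arcs D = gedges G - gedges H" using D by (simp add: orientation_of_def)
  have bF: "boundary D' F v = boundary D f v
      + (\<Sum>i<n. (if r i = v then x i else 0) - (if r (Suc i mod n) = v then x i else 0))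
      + (\<Sum>i<n. (if c = v then s i else 0) - (if r i = v then s i else 0))" for v
  proof -
    define k where "k e = (if tail D' e = v then F e else 0) - (if head D' e = v then F e else 0)" for e
    have "boundary D' F v = (\<Sum>e\<in>gedges G. k e)"
      using boundary_eq_sum[OF fin_digraph.finite_arcs[OF fin], of F v] by (simp add: k_def D'_def)
    also have "\<dots> = (\<Sum>e\<in>gedges G - gedges H. k e) + (\<Sum>e\<in>gedges H. k e)"
      by (rule sum.subset_diff[OF HG(1) finG])
    also have "(\<Sum>e\<in>gedges H. k e) = (\<Sum>e\<in>\<rho> ` ?I. k e) + (\<Sum>e\<in>\<sigma> ` ?I. k e)"
      unfolding E using \<rho>\<sigma>(3) by (intro sum.union_disjoint) auto
    also have "(\<Sum>e\<in>\<rho> ` ?I. k e) = (\<Sum>i<n. k (\<rho> i))" using sum.reindex[OF \<rho>\<sigma>(1)] by simp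
    also have "\<dots> = (\<Sum>i<n. (if r i = v then x i else 0) - (if r (Suc i mod n) = v then x i else 0))"
      by (rule sum.cong) (auto simp: k_def D'_def F_def \<rho>')
    also have "(\<Sum>e\<in>\<sigma> ` ?I. k e) = (\<Sum>i<n. k (\<sigma> i))" using sum.reindex[OF \<rho>\<sigma>(2)] by simp
    also have "\<dots> = (\<Sum>i<n. (if c = v then s i else 0) - (if r i = v then s i else 0))"
      by (rule sum.cong) (auto simp: k_def D'_def F_def \<sigma>' not_rim)
    also have "(\<Sum>e\<in>gedges G - gedges H. k e) =
        (\<Sum>e\<in>arcs D. (if tail D e = v then f e else 0) - (if head D e = v then f e else 0))"
    proof (rule sum.cong[OF arcsD[symmetric]])
      fix e assume "e \<in> arcs D"
      then have "e \<notin> \<rho> ` ?I" "e \<notin> \<sigma> ` ?I" using arcsD E by auto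
      then show "k e = (if tail D e = v then f e else 0) - (if head D e = v then f e else 0)"
        by (simp add: k_def D'_def F_def)
    qed
    also have "\<dots> = boundary D f v" using finG arcsD by (simp add: boundary_eq_sum)
    finally show ?thesis by simp
  qed
  have rim0: "boundary D' F (r j) = 0" if j: "j < n" for j
  proof -
    have eq: "r i = r j \<longleftrightarrow> i = j" if "i < n" for i using r(1) that j by (auto simp: inj_on_def)
    have "(\<Sum>i<n. (if r i = r j then x i else 0) - (if r (Suc i mod n) = r j then x i else 0))
      = (\<Sum>i<n. (if i = j then x i else 0) - (if i = pred j then x i else 0))"
    proof (rule sum.cong[OF refl])
      fix i assume "i \<in> ?I"
      then have i: "i < n" "Suc i mod n < n" using assms(3) by simp_all
      show "(if r i = r j then x i else 0) - (if r (Suc i mod n) = r j then x i else 0)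
        = (if i = j then x i else 0) - (if i = pred j then x i else 0)"
        unfolding eq[OF i(1)] eq[OF i(2)] pred[OF i(1) j] ..
    qed
    also have "\<dots> = x j - x (pred j)" using j pred_less by (simp add: sum_subtractf)
    finally have 1: "(\<Sum>i<n. (if r i = r j then x i else 0) - (if r (Suc i mod n) = r j then x i else 0))
      = x j - x (pred j)" .
    have "(\<Sum>i<n. (if c = r j then s i else 0) - (if r i = r j then s i else 0))
      = (\<Sum>i<n. - (if i = j then s i else 0))"
      using j r(2) by (intro sum.cong) (auto simp: eq)
    also have "\<dots> = - s j" using j by (simp add: sum_negf)
    finally show ?thesis unfolding bF 1 by (simp add: s_def)
  qed
  have out0: "boundary D' F v = 0" if v: "v \<in> gverts G - gverts H" for v
  proof -
    have "v \<noteq> c" "\<And>i. i < n \<Longrightarrow> r i \<noteq> v" using v r(3) by auto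
    moreover have "Suc i mod n < n" for i using assms(3) by simp
    ultimately show ?thesis unfolding bF using f(2)[OF v] by simp
  qed
  have others: "boundary D' F v = 0" if "v \<in> gverts G - {c}" for v
    using that rim0 out0 r(3) by blast
  have "c \<in> gverts G" "finite (gverts G)" using r(3) HG(2) assms(1) by (auto simp: finite_mgraph_def)
  then have "(\<Sum>v\<in>gverts G. boundary D' F v) = boundary D' F c"
    using others by (subst sum.remove[of _ c]) auto
  then have hub0: "boundary D' F c = 0"
    using sum_boundary_verts[OF fin, of F] by (simp add: D'_def)
  show ?thesis
  proof (rule admits_S1_flow_complex[OF D'])
    show "norm (F e) = 1" for e using x1 s1 f(1) by (auto simp: F_def \<rho>' \<sigma>')
    show "boundary D' F v = 0" if "v \<in> gverts G" for v
      using that others hub0 by (cases "v = c") auto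
  qed
qed

lemma boundary_restrict:
  assumes "orientation_of D G" "finite_mgraph G" "subgraph_of H G" "v \<in> gverts G - gverts H"
  shows "boundary (D\<lparr>arcs := gedges G - gedges H\<rparr>) f v = boundary D f v"
proof -
  have "tail D e \<noteq> v \<and> head D e \<noteq> v" if e: "e \<in> gedges H" for e
  proof -
    have "gends G e = gends H e" "gends H e \<subseteq> gverts H" "e \<in> gedges G"
      using assms(3) e unfolding subgraph_of_def finite_mgraph_def by blast+
    moreover have "gends G e = {tail D e, head D e}"
      using assms(1) \<open>e \<in> gedges G\<close> by (simp add: orientation_of_def)
    ultimately show ?thesis using assms(4) by auto
  qed
  then have "out_arcs (D\<lparr>arcs := gedges G - gedges H\<rparr>) v = out_arcs D v"
    "in_arcs (D\<lparr>arcs := gedges G - gedges H\<rparr>) v = in_arcs D v"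
    using assms(1) by (auto simp: out_arcs_def in_arcs_def orientation_of_def)
  then show ?thesis by (simp add: boundary_def)
qed

theorem theorem3p11:
  fixes G H :: "('a, 'e) mgraph" and n :: nat
  assumes "finite_mgraph G"
    and "k_connected 2 G"
    and "n \<ge> 3"
    and "isomorphic_mgraph H (wheel_graph n)"
    and "proper_subgraph_of H G"
    and "admits_nowhere_zero_3_flow (contract G H)"
  shows "admits_S1_flow G"
proof -
  have sub: "subgraph_of H G" using assms(5) by (simp add: proper_subgraph_of_def)
  then have finH: "finite_mgraph H" and HG: "gverts H \<subseteq> gverts G" by (simp_all add: subgraph_of_def)
  obtain r c \<rho> \<sigma> where r: "inj_on r {..<n}" "c \<notin> r ` {..<n}" "gverts H = insert c (r ` {..<n})"
    and edges: "inj_on \<rho> {..<n}" "inj_on \<sigma> {..<n}" "\<rho> ` {..<n} \<inter> \<sigma> ` {..<n} = {}"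
      "gedges H = \<rho> ` {..<n} \<union> \<sigma> ` {..<n}"
      "\<And>i. i < n \<Longrightarrow> gends H (\<rho> i) = {r i, r (Suc i mod n)}"
      "\<And>i. i < n \<Longrightarrow> gends H (\<sigma> i) = {c, r i}"
    using wheel_labelling[OF assms(3) finH assms(4)] by blast
  obtain D0 where D0: "orientation_of D0 G"
    and div0: "\<And>v. v \<in> gverts G - gverts H \<Longrightarrow> \<exists>k :: int. boundary D0 (\<lambda>_. 1 :: real) v = 3 * real_of_int k"
    using orientation_from_contraction[OF assms(1) sub assms(6)] by blast
  define \<Gamma> where "\<Gamma> = G\<lparr>gedges := gedges G - gedges H\<rparr>"
  define D where "D = D0\<lparr>arcs := gedges G - gedges H\<rparr>"
  have D: "orientation_of D \<Gamma>" using D0 by (auto simp: orientation_of_def D_def \<Gamma>_def)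
  have "finite_mgraph \<Gamma>" using assms(1) by (auto simp: finite_mgraph_def \<Gamma>_def)
  then have fin: "fin_digraph D" using D by (rule fin_digraph_orientation)
  have vD: "verts D = gverts G" using D by (simp add: orientation_of_def \<Gamma>_def)
  let ?div = "\<lambda>v. \<exists>k :: int. boundary D (\<lambda>_. 1 :: real) v = 3 * real_of_int k"
  have div: "?div v" if "v \<in> gverts G - gverts H" for v
    using div0[OF that] boundary_restrict[OF D0 assms(1) sub that] unfolding D_def by metis
  have rG: "r i \<in> gverts G" if "i < n" for i using that HG r(3) by auto
  have cG: "c \<in> gverts G" using HG r(3) by auto
  note extend = extend_over_wheel[OF assms(1) sub assms(3) r edges D[unfolded \<Gamma>_def]]
  show ?thesis
  proof (cases "even n \<or> (\<exists>j<n. \<not> ?div (r j))")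
    case True
    obtain f :: "'e \<Rightarrow> complex" where f: "\<And>e. norm (f e) = 1"
      and f0: "\<And>v k. v \<in> verts D \<Longrightarrow> boundary D (\<lambda>_. 1 :: real) v = 3 * real_of_int k \<Longrightarrow> boundary D f v = 0"
      and f1: "\<And>v. v \<in> verts D \<Longrightarrow> \<not> ?div v \<Longrightarrow> norm (boundary D f v) = 1"
      using unit_or_zero_boundary[OF fin] by blast
    have rim: "boundary D f (r i) = 0 \<or> norm (boundary D f (r i)) = 1" if "i < n" for i
      using f0[of "r i"] f1[of "r i"] rG[OF that] unfolding vD by blast
    have "\<exists>x. closes_wheel n (\<lambda>i. boundary D f (r i)) x"
    proof (cases "\<exists>j<n. \<not> ?div (r j)")
      case True
      then obtain j where j: "j < n" "\<not> ?div (r j)" by blast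
      then have "norm (boundary D f (r j)) = 1" using f1 rG vD by blast
      then show ?thesis using rim by (rule closes_wheel_unit[OF j(1)])
    next
      case False
      then have "even n" using \<open>even n \<or> (\<exists>j<n. \<not> ?div (r j))\<close> by blast
      moreover have "boundary D f (r i) = 0" if "i < n" for i
        using False f0[of "r i"] rG[OF that] that unfolding vD by blast
      moreover have "0 < n" using assms(3) by simp
      ultimately show ?thesis by (intro closes_wheel_even)
    qed
    moreover have "boundary D f v = 0" if "v \<in> gverts G - gverts H" for v
      using div[OF that] f0 that vD by blast
    ultimately show ?thesis using extend f by blast
  next
    case False
    then have odd: "odd n" and rim: "\<And>j. j < n \<Longrightarrow> ?div (r j)" by auto
    have others: "?div v" if "v \<in> gverts G - {c}" for v
      using div rim that r(3) by blast
    \<comment> \<open>The boundaries add up to zero, so divisibility at all other vertices passes on to the hub.\<close>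
    have "?div c"
    proof -
      obtain k :: "'a \<Rightarrow> int" where k: "\<And>v. v \<in> gverts G - {c} \<Longrightarrow> boundary D (\<lambda>_. 1 :: real) v = 3 * real_of_int (k v)"
        using others by metis
      have "0 = (\<Sum>v\<in>gverts G. boundary D (\<lambda>_. 1 :: real) v)"
        using sum_boundary_verts[OF fin, of "\<lambda>_. 1 :: real"] by (simp add: vD)
      also have "\<dots> = boundary D (\<lambda>_. 1) c + (\<Sum>v\<in>gverts G - {c}. 3 * real_of_int (k v))"
        using cG assms(1) k by (subst sum.remove[of _ c]) (auto simp: finite_mgraph_def)
      finally have "boundary D (\<lambda>_. 1 :: real) c = 3 * real_of_int (- (\<Sum>v\<in>gverts G - {c}. k v))"
        by (simp add: sum_distrib_left)
      then show ?thesis by blast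
    qed
    then have all: "?div v" if "v \<in> verts D" for v using others that vD by blast
    have "c \<noteq> r 0" using r(2) assms(3) by auto
    moreover have "c \<in> gverts H" "r 0 \<in> gverts H" using r(3) assms(3) by auto
    ultimately obtain u w where uw: "u \<in> gverts H" "w \<in> gverts H" "w \<noteq> u" "(u, w) \<in> (adjacency \<Gamma>)\<^sup>*"
      using two_attached_vertices[OF assms(1,2,5)] unfolding \<Gamma>_def by metis
    have "u \<in> verts D" using uw(1) HG vD by blast
    then obtain f :: "'e \<Rightarrow> complex" and b where f: "\<And>e. norm (f e) = 1" "norm b = sqrt 3"
      "boundary D f u = b" "boundary D f w = - b"
      and f0: "\<And>v. v \<in> verts D \<Longrightarrow> v \<noteq> u \<Longrightarrow> v \<noteq> w \<Longrightarrow> boundary D f v = 0"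
      using sqrt3_boundary_at_two_vertices[OF fin D all _ uw(3,4)] by blast
    have zero: "boundary D f (r i) = 0" if "i < n" "r i \<noteq> u" "r i \<noteq> w" for i
      using f0[of "r i"] that rG vD by simp
    have ri: "i = j" if "i < n" "j < n" "r i = r j" for i j
      using r(1) that by (auto simp: inj_on_def)
    \<comment> \<open>The hub may be one of \<open>u\<close> and \<open>w\<close>; then the rim sees a single non-zero demand.\<close>
    have "\<exists>x. closes_wheel n (\<lambda>i. boundary D f (r i)) x"
    proof -
      have cases_uw: "u = c \<or> (\<exists>j<n. u = r j)" "w = c \<or> (\<exists>j<n. w = r j)"
        using uw(1,2) r(3) by auto
      consider j where "j < n" "u = r j" "w = c" | j where "j < n" "w = r j" "u = c"
        | j k where "j < n" "k < n" "u = r j" "w = r k"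
        using uw(3) cases_uw by blast
      then show ?thesis
      proof cases
        case (1 j)
        have "boundary D f (r i) = 0" if "i < n" "i \<noteq> j" for i
          using zero[OF that(1)] ri[OF that(1) 1(1)] that 1 r(2) by blast
        then show ?thesis
          using f(2,3) 1 by (intro closes_wheel_one_sqrt3[OF odd assms(3), of j]) auto
      next
        case (2 j)
        have "boundary D f (r i) = 0" if "i < n" "i \<noteq> j" for i
          using zero[OF that(1)] ri[OF that(1) 2(1)] that 2 r(2) by blast
        then show ?thesis
          using f(2,4) 2 by (intro closes_wheel_one_sqrt3[OF odd assms(3), of j]) auto
      next
        case (3 j k)
        have "boundary D f (r i) = 0" if "i < n" "i \<noteq> j" "i \<noteq> k" for i
          using zero[OF that(1)] ri[OF that(1) 3(1)] ri[OF that(1) 3(2)] that 3 by blast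
        then show ?thesis
          using f(2-4) 3 uw(3) by (intro closes_wheel_two_sqrt3[OF odd, of j k]) auto
      qed
    qed
    moreover have "boundary D f v = 0" if "v \<in> gverts G - gverts H" for v
      using f0[of v] that vD uw(1,2) by blast
    ultimately show ?thesis using extend f(1) by blast
  qed
qed

end
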